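(* Let $k\ge1$ and let $f:D\to\Lambda\times\mathbb{R}^u\times\mathbb{R}^s$ be a $C^{k+1}$ map satisfying the covering conditions, the rate conditions of order $k$ and the backward cone conditions (so that $W^{cu}=\{(\lambda,x,w^{cu}(\lambda,x)):\lambda\in\Lambda,x\in\overline B_u(R)\}$ for a function $w^{cu}:\Lambda\times\overline B_u(R)\to\overline B_s(R)$). Let $M\in(0,L)$ and $\xi=\inf_{z\in D}m[\partial f_{(\lambda,x)}/\partial(\lambda,x)(P(z))]-M\sup_{z\in D}\|\partial f_{(\lambda,x)}/\partial y(z)\|$, $\mu=\sup_{z\in D}\{\|\partial f_y/\partial y(z)\|+\frac1M\|\partial f_y/\partial(\lambda,x)(z)\|\}$. If $\xi/\mu>1$, then $w^{cu}$ is Lipschitz with constant $M$.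
   Context: $c,u,s$ positive integers, $\Lambda=(\mathbb{R}/\mathbb{Z})^c$, $R_\Lambda=\tfrac12$; points are "in the same chart" if their $\lambda$-components have lifts to $\mathbb{R}^c$ at distance $\le R_\Lambda$; differences, norms, cones, derivatives and Lipschitz constants are computed in such lifts; $\overline B_c(\lambda,R_\Lambda)$ closed ball about a lift of $\lambda$. $B_n(R),\overline B_n(R)$ open/closed balls at $0$; Euclidean norms. $0<R<R_\Lambda/2$, $D=\Lambda\times\overline B_u(R)\times\overline B_s(R)$, $z=(\lambda,x,y)$, projections $\pi_\lambda,\pi_x,\pi_y,\pi_{(\lambda,x)},\pi_{(\lambda,y)}$, $f=(f_\lambda,f_x,f_y)$. $m(A)=\max\{c:\|Av\|\ge c\|v\|\}$, $m(\mathbf A)=\inf_{A\in\mathbf A}m(A)$; $[\partial g/\partial w(U)]$ = matrices with $(i,j)$ entry in $[\inf_U\partial g_i/\partial w_j,\sup_U\partial g_i/\partial w_j]$; $P(z)=\{w\in D:\|\pi_\lambda w-\pi_\lambda z\|\le R_\Lambda/2\}$. Fix $L\in(2R/R_\Lambda,1)$; constants $\mu_{s,1}=\sup_{D}\{\|\partial_y f_y\|+\frac1L\|\partial_{(\lambda,x)}f_y\|\}$, $\mu_{s,2}=\sup_D\{\|\partial_yf_y\|+L\|\partial_yf_{(\lambda,x)}\|\}$, $\xi_{u,1}=\inf_D\{m(\partial_xf_x)-\frac1L\|\partial_{(\lambda,y)}f_x\|\}$, $\xi_{u,1,P}=\inf_{z\in D}m[\partial_xf_x(P(z))]-\frac1L\sup_D\|\partial_{(\lambda,y)}f_x\|$,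 $\xi_{u,2}=\inf_D\{m(\partial_xf_x)-L\|\partial_xf_{(\lambda,y)}\|\}$, $\mu_{cs,1}=\sup_D\{\|\partial_{(\lambda,y)}f_{(\lambda,y)}\|+L\|\partial_xf_{(\lambda,y)}\|\}$, $\mu_{cs,2}=\sup_D\{\|\partial_{(\lambda,y)}f_{(\lambda,y)}\|+\frac1L\|\partial_{(\lambda,y)}f_x\|\}$, $\xi_{cu,1}=\inf_D\{m(\partial_{(\lambda,x)}f_{(\lambda,x)})-L\|\partial_yf_{(\lambda,x)}\|\}$, $\xi_{cu,1,P}=\inf_{z\in D}m[\partial_{(\lambda,x)}f_{(\lambda,x)}(P(z))]-L\sup_D\|\partial_yf_{(\lambda,x)}\|$, $\xi_{cu,2}=\inf_D\{m(\partial_{(\lambda,x)}f_{(\lambda,x)})-\frac1L\|\partial_{(\lambda,x)}f_y\|\}$. Rate conditions of order $k$: all $\xi$'s positive; $\mu_{s,1}<1<\xi_{u,1,P}$; $\mu_{cs,1}<\xi_{u,1,P}$; $\mu_{s,1}<\xi_{cu,1,P}$; for $1\le j\le k$: $\mu_{cs,1}^{j+1}<\xi_{u,2}$, $\mu_{s,2}<\xi_{cu,1}^{j+1}$; $\mu_{cs,2}<\xi_{u,1}$; $\mu_{s,1}<\xi_{cu,2}$. Cones $J_s(z,M)=\{\|(\lambda,x)-\pi_{(\lambda,x)}z\|\le M\|y-\pi_yz\|\}$, $J_u(z,M)=\{\|(\lambda,y)-\pi_{(\lambda,y)}z\|\le M\|x-\pi_xz\|\}$. $W^{cu}=\{z:$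 there is a full backward trajectory $\{z_i\}_{i\le0}$ ($z_0=z$, $f(z_{i-1})=z_i$) of $z$ in $D\}$. Backward cone conditions: if $z_1,z_2,f(z_1),f(z_2)\in D$ and $f(z_1)\in J_s(f(z_2),1/L)$ then $z_1\in J_s(z_2,1/L)$. Covering conditions: with $D_\lambda=\overline B_c(\lambda,R_\Lambda)\times\overline B_u(R)\times\overline B_s(R)$, $D^+_\lambda=\overline B_c(\lambda,R_\Lambda)\times\overline B_u(R)\times\partial B_s(R)$, $D^-_\lambda=\overline B_c(\lambda,R_\Lambda)\times\partial B_u(R)\times B_s(R)$: for each $z\in D$ there exist $\lambda^*$, a homotopy $h:[0,1]\times U\to B_c(\lambda^*,R_\Lambda)\times\mathbb{R}^u\times\mathbb{R}^s$ ($U=J_u(z,1/L)\cap D$) and linear $A$ with $h_0=f|_U$, $h_\alpha(U\cap D^-_{\pi_\lambda z})\cap D_{\lambda^*}=\emptyset$, $h_\alpha(U)\cap D^+_{\lambda^*}=\emptyset$ for all $\alpha$, $h_1(\lambda,x,y)=(\lambda^*,Ax,0)$, $A(\partial B_u(R))\subset\mathbb{R}^u\setminus\overline B_u(R)$. *)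

theory Defs
  imports "HOL-Analysis.Analysis"
begin

text \<open>
  Phase space: points z = (lambda, x, y).  The torus Lambda = (R/Z)^c is represented by
  lifts in real^'c; everything below is stated for lifts.  Two lifts represent the same
  torus point iff they differ by an element of the integer lattice.
\<close>

type_synonym ('c,'u,'s) st = "(real^'c) \<times> (real^'u) \<times> (real^'s)"

definition Zlat :: "(real^'c::finite) set" where
  "Zlat = {l. \<forall>i. l $ i \<in> \<int>}"

definition RLam :: real where "RLam = 1/2"

definition pl :: "('c::finite,'u::finite,'s::finite) st \<Rightarrow> real^'c" where "pl z = fst z"
definition px :: "('c::finite,'u::finite,'s::finite) st \<Rightarrow> real^'u" where "px z = fst (snd z)"
definition py :: "('c::finite,'u::finite,'s::finite) st \<Rightarrow> real^'s" where "py z = snd (snd z)"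
definition plx :: "('c::finite,'u::finite,'s::finite) st \<Rightarrow> (real^'c) \<times> (real^'u)" where "plx z = (pl z, px z)"
definition ply :: "('c::finite,'u::finite,'s::finite) st \<Rightarrow> (real^'c) \<times> (real^'s)" where "ply z = (pl z, py z)"

definition ex :: "real^'u::finite \<Rightarrow> ('c::finite,'u::finite,'s::finite) st" where "ex x = (0, x, 0)"
definition ey :: "real^'s \<Rightarrow> ('c::finite,'u::finite,'s::finite) st" where "ey y = (0, 0, y)"
definition elx :: "(real^'c) \<times> (real^'u) \<Rightarrow> ('c::finite,'u::finite,'s::finite) st" where "elx v = (fst v, snd v, 0)"
definition ely :: "(real^'c) \<times> (real^'s) \<Rightarrow> ('c::finite,'u::finite,'s::finite) st" where "ely v = (fst v, 0, snd v)"

definition eqv :: "('c::finite,'u::finite,'s::finite) st \<Rightarrow> ('c::finite,'u::finite,'s::finite) st \<Rightarrow> bool" where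
  "eqv z w \<longleftrightarrow> pl z - pl w \<in> Zlat \<and> px z = px w \<and> py z = py w"

definition Dset :: "real \<Rightarrow> ('c::finite,'u::finite,'s::finite) st set" where
  "Dset R = {z. norm (px z) \<le> R \<and> norm (py z) \<le> R}"

definition Pset :: "real \<Rightarrow> ('c::finite,'u::finite,'s::finite) st \<Rightarrow> ('c::finite,'u::finite,'s::finite) st set" where
  "Pset R z = {w \<in> Dset R. norm (pl w - pl z) \<le> RLam / 2}"

text \<open>C^k on an open set (finite dimensions): all iterated directional derivatives
  up to order k exist and are continuous.  D vs x is the derivative of f at x
  in the directions of the list vs.\<close>
definition Ck_on :: "nat \<Rightarrow> ('a::euclidean_space \<Rightarrow> 'b::euclidean_space) \<Rightarrow> 'a set \<Rightarrow> bool" where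
  "Ck_on k f S \<longleftrightarrow> open S \<and>
     (\<exists>D :: 'a list \<Rightarrow> 'a \<Rightarrow> 'b.
        (\<forall>x\<in>S. D [] x = f x) \<and>
        (\<forall>vs. length vs < k \<longrightarrow> (\<forall>x\<in>S. (D vs has_derivative (\<lambda>v. D (v # vs) x)) (at x))) \<and>
        (\<forall>vs. length vs \<le> k \<longrightarrow> continuous_on S (D vs)))"

definition DF :: "(('c::finite,'u::finite,'s::finite) st \<Rightarrow> ('c::finite,'u::finite,'s::finite) st) \<Rightarrow> ('c::finite,'u::finite,'s::finite) st \<Rightarrow> ('c::finite,'u::finite,'s::finite) st \<Rightarrow> ('c::finite,'u::finite,'s::finite) st" where
  "DF F z = frechet_derivative F (at z)"

definition dyfy where "dyfy (F :: ('c::finite,'u::finite,'s::finite) st \<Rightarrow> ('c,'u,'s) st) z = py \<circ> DF F z \<circ> ey"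
definition dlxfy where "dlxfy (F :: ('c::finite,'u::finite,'s::finite) st \<Rightarrow> ('c,'u,'s) st) z = py \<circ> DF F z \<circ> elx"
definition dyflx where "dyflx (F :: ('c::finite,'u::finite,'s::finite) st \<Rightarrow> ('c,'u,'s) st) z = plx \<circ> DF F z \<circ> ey"
definition dxfx where "dxfx (F :: ('c::finite,'u::finite,'s::finite) st \<Rightarrow> ('c,'u,'s) st) z = px \<circ> DF F z \<circ> ex"
definition dlyfx where "dlyfx (F :: ('c::finite,'u::finite,'s::finite) st \<Rightarrow> ('c,'u,'s) st) z = px \<circ> DF F z \<circ> ely"
definition dxfly where "dxfly (F :: ('c::finite,'u::finite,'s::finite) st \<Rightarrow> ('c,'u,'s) st) z = ply \<circ> DF F z \<circ> ex"
definition dlyfly where "dlyfly (F :: ('c::finite,'u::finite,'s::finite) st \<Rightarrow> ('c,'u,'s) st) z = ply \<circ> DF F z \<circ> ely"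
definition dlxflx where "dlxflx (F :: ('c::finite,'u::finite,'s::finite) st \<Rightarrow> ('c,'u,'s) st) z = plx \<circ> DF F z \<circ> elx"

definition mnorm :: "('a::real_normed_vector \<Rightarrow> 'b::real_normed_vector) \<Rightarrow> real" where
  "mnorm A = Sup {c. \<forall>v. c * norm v \<le> norm (A v)}"

definition mset :: "('a::real_normed_vector \<Rightarrow> 'b::real_normed_vector) set \<Rightarrow> real" where
  "mset As = Inf (mnorm ` As)"

text \<open>Interval matrix [dg/dw(U)]: matrices (linear maps) whose (i,j) entry lies between
  the inf and sup over U of the (i,j) partial derivative.\<close>
definition ivl_mat :: "('z::type \<Rightarrow> 'a::euclidean_space \<Rightarrow> 'b::euclidean_space) \<Rightarrow> 'z set \<Rightarrow> ('a \<Rightarrow> 'b) set" where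
  "ivl_mat g' U = {A. linear A \<and> (\<forall>i\<in>Basis. \<forall>j\<in>Basis.
      (INF z\<in>U. g' z j \<bullet> i) \<le> A j \<bullet> i \<and> A j \<bullet> i \<le> (SUP z\<in>U. g' z j \<bullet> i))}"

definition mu_s1 where "mu_s1 (F :: ('c::finite,'u::finite,'s::finite) st \<Rightarrow> ('c,'u,'s) st) R K = (SUP z\<in>Dset R. onorm (dyfy F z) + 1/K * onorm (dlxfy F z))"
definition mu_s2 where "mu_s2 (F :: ('c::finite,'u::finite,'s::finite) st \<Rightarrow> ('c,'u,'s) st) R K = (SUP z\<in>Dset R. onorm (dyfy F z) + K * onorm (dyflx F z))"
definition xi_u1 where "xi_u1 (F :: ('c::finite,'u::finite,'s::finite) st \<Rightarrow> ('c,'u,'s) st) R K = (INF z\<in>Dset R. mnorm (dxfx F z) - 1/K * onorm (dlyfx F z))"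
definition xi_u1P where "xi_u1P (F :: ('c::finite,'u::finite,'s::finite) st \<Rightarrow> ('c,'u,'s) st) R K =
   (INF z\<in>Dset R. mset (ivl_mat (dxfx F) (Pset R z))) - 1/K * (SUP z\<in>Dset R. onorm (dlyfx F z))"
definition xi_u2 where "xi_u2 (F :: ('c::finite,'u::finite,'s::finite) st \<Rightarrow> ('c,'u,'s) st) R K = (INF z\<in>Dset R. mnorm (dxfx F z) - K * onorm (dxfly F z))"
definition mu_cs1 where "mu_cs1 (F :: ('c::finite,'u::finite,'s::finite) st \<Rightarrow> ('c,'u,'s) st) R K = (SUP z\<in>Dset R. onorm (dlyfly F z) + K * onorm (dxfly F z))"
definition mu_cs2 where "mu_cs2 (F :: ('c::finite,'u::finite,'s::finite) st \<Rightarrow> ('c,'u,'s) st) R K = (SUP z\<in>Dset R. onorm (dlyfly F z) + 1/K * onorm (dlyfx F z))"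
definition xi_cu1 where "xi_cu1 (F :: ('c::finite,'u::finite,'s::finite) st \<Rightarrow> ('c,'u,'s) st) R K = (INF z\<in>Dset R. mnorm (dlxflx F z) - K * onorm (dyflx F z))"
definition xi_cu1P where "xi_cu1P (F :: ('c::finite,'u::finite,'s::finite) st \<Rightarrow> ('c,'u,'s) st) R K =
   (INF z\<in>Dset R. mset (ivl_mat (dlxflx F) (Pset R z))) - K * (SUP z\<in>Dset R. onorm (dyflx F z))"
definition xi_cu2 where "xi_cu2 (F :: ('c::finite,'u::finite,'s::finite) st \<Rightarrow> ('c,'u,'s) st) R K = (INF z\<in>Dset R. mnorm (dlxflx F z) - 1/K * onorm (dlxfy F z))"

definition rate_conditions :: "nat \<Rightarrow> (('c::finite,'u::finite,'s::finite) st \<Rightarrow> ('c::finite,'u::finite,'s::finite) st) \<Rightarrow> real \<Rightarrow> real \<Rightarrow> bool" where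
  "rate_conditions k F R L \<longleftrightarrow>
     0 < xi_u1 F R L \<and> 0 < xi_u1P F R L \<and> 0 < xi_u2 F R L \<and>
     0 < xi_cu1 F R L \<and> 0 < xi_cu1P F R L \<and> 0 < xi_cu2 F R L \<and>
     mu_s1 F R L < 1 \<and> 1 < xi_u1P F R L \<and>
     mu_cs1 F R L < xi_u1P F R L \<and> mu_s1 F R L < xi_cu1P F R L \<and>
     (\<forall>j\<in>{1..k}. mu_cs1 F R L ^ (j+1) < xi_u2 F R L \<and> mu_s2 F R L < xi_cu1 F R L ^ (j+1)) \<and>
     mu_cs2 F R L < xi_u1 F R L \<and> mu_s1 F R L < xi_cu2 F R L"

text \<open>Cones (membership of w in J_s(z,M), J_u(z,M)); differences computed in a lift of w
  lying in the same chart as the lift of z.\<close>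
definition in_Js :: "('c::finite,'u::finite,'s::finite) st \<Rightarrow> real \<Rightarrow> ('c::finite,'u::finite,'s::finite) st \<Rightarrow> bool" where
  "in_Js z M w \<longleftrightarrow> (\<exists>n\<in>Zlat. norm (pl w + n - pl z) \<le> RLam \<and>
      norm ((pl w + n - pl z, px w - px z)) \<le> M * norm (py w - py z))"

definition backward_cone_conditions :: "(('c::finite,'u::finite,'s::finite) st \<Rightarrow> ('c::finite,'u::finite,'s::finite) st) \<Rightarrow> real \<Rightarrow> real \<Rightarrow> bool" where
  "backward_cone_conditions F R L \<longleftrightarrow>
     (\<forall>z1 z2. z1 \<in> Dset R \<longrightarrow> z2 \<in> Dset R \<longrightarrow> F z1 \<in> Dset R \<longrightarrow> F z2 \<in> Dset R \<longrightarrow>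
        in_Js (F z2) (1/L) (F z1) \<longrightarrow> in_Js z2 (1/L) z1)"

text \<open>U = J_u(z,1/L) cap D, represented by the lifts lying in the chart around the lift of z.\<close>
definition Uset :: "real \<Rightarrow> real \<Rightarrow> ('c::finite,'u::finite,'s::finite) st \<Rightarrow> ('c::finite,'u::finite,'s::finite) st set" where
  "Uset R L z = {w \<in> Dset R. norm (pl w - pl z) \<le> RLam \<and>
      norm ((pl w - pl z, py w - py z)) \<le> (1/L) * norm (px w - px z)}"

definition Dloc :: "real \<Rightarrow> real^'c \<Rightarrow> ('c::finite,'u::finite,'s::finite) st set" where
  "Dloc R lam = cball lam RLam \<times> cball 0 R \<times> cball 0 R"
definition Dplus :: "real \<Rightarrow> real^'c \<Rightarrow> ('c::finite,'u::finite,'s::finite) st set" where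
  "Dplus R lam = cball lam RLam \<times> cball 0 R \<times> sphere 0 R"
definition Dminus :: "real \<Rightarrow> real^'c \<Rightarrow> ('c::finite,'u::finite,'s::finite) st set" where
  "Dminus R lam = cball lam RLam \<times> sphere 0 R \<times> ball 0 R"

text \<open>Covering conditions.  h(0,.) = f on U means h(0,w) is the lift (in the chart
  B_c(lam*,R_Lambda)) of f(w).\<close>
definition covering_conditions :: "(('c::finite,'u::finite,'s::finite) st \<Rightarrow> ('c::finite,'u::finite,'s::finite) st) \<Rightarrow> real \<Rightarrow> real \<Rightarrow> bool" where
  "covering_conditions F R L \<longleftrightarrow>
     (\<forall>z\<in>Dset R. \<exists>(lam::real^'c) (h::real \<times> ('c::finite,'u::finite,'s::finite) st \<Rightarrow> ('c::finite,'u::finite,'s::finite) st) (A::real^'u \<Rightarrow> real^'u).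
        continuous_on ({0..1} \<times> Uset R L z) h \<and>
        h ` ({0..1} \<times> Uset R L z) \<subseteq> ball lam RLam \<times> UNIV \<times> UNIV \<and>
        (\<forall>w\<in>Uset R L z. eqv (h (0, w)) (F w)) \<and>
        (\<forall>\<alpha>\<in>{0..1}. (\<lambda>w. h (\<alpha>, w)) ` (Uset R L z \<inter> Dminus R (pl z)) \<inter> Dloc R lam = {} \<and>
                      (\<lambda>w. h (\<alpha>, w)) ` (Uset R L z) \<inter> Dplus R lam = {}) \<and>
        (\<forall>w\<in>Uset R L z. h (1, w) = (lam, A (px w), 0)) \<and>
        linear A \<and> A ` sphere 0 R \<subseteq> - cball 0 R)"

definition Wcu :: "(('c::finite,'u::finite,'s::finite) st \<Rightarrow> ('c::finite,'u::finite,'s::finite) st) \<Rightarrow> real \<Rightarrow> ('c::finite,'u::finite,'s::finite) st set" where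
  "Wcu F R = {z. \<exists>zs :: nat \<Rightarrow> ('c::finite,'u::finite,'s::finite) st. zs 0 = z \<and>
      (\<forall>n. zs n \<in> Dset R \<and> eqv (F (zs (Suc n))) (zs n))}"

definition is_torus_lift :: "(('c::finite,'u::finite,'s::finite) st \<Rightarrow> ('c::finite,'u::finite,'s::finite) st) \<Rightarrow> real \<Rightarrow> bool" where
  "is_torus_lift F R \<longleftrightarrow>
     (\<forall>z\<in>Dset R. \<forall>n\<in>Zlat. eqv (F (pl z + n, px z, py z)) (F z))"

end

theory Submission
  imports Defs
begin

text \<open>
  Existence: the graph transform maps graphs over (lambda, x) satisfying the cone condition to
  graphs of the same kind.  The set of (lambda, x) hit by the image of a graph is open by invariance
  of domain, closed by compactness modulo the lattice, and nonempty by a Brouwer argument from the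
  covering homotopy, hence everything.  Compactness then gives a full backward trajectory over each
  (lambda, x).  Uniqueness: by the backward cone conditions two backward trajectories starting in a
  common stable cone stay there, so their y-distance expands by 1 / mu_s1 at each backward step,
  which is impossible in a bounded set.

  Lipschitz constant: K xi_cu1P(K) - K mu_s1(K) is a concave function of K, positive at K = M and at
  K = L, hence on [M, L].  So invariance of the graph under F improves any Lipschitz constant K in
  (M, L] to a strictly smaller one, and the best constant in [M, L] has to be M.
\<close>

text \<open>The covering and backward cone conditions speak of cones of slope 1/L only, so the graph
  has to be built with slope L; and the expansion estimate with constant
  \<open>xi_cu1P F R K\<close> presupposes a graph that already has slope K. The slope M must
  therefore be approached from L, which requires control at every intermediate K although the
  hypotheses compare \<open>mu_s1\<close> and \<open>xi_cu1P\<close> at the two ends only. This is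
  what the concavity is for.

  A second obstacle: a graph over all (lambda, x) is wanted, while the covering condition handles
  one unstable cone at a time. A disc over a single lambda yields one point of the image, and
  connectedness supplies the rest. The boundary does not spoil openness, because a point with norm x
  = R and norm y < R is mapped out of D, so the preimages that matter are interior.

  The expansion estimates hold only for points close in lambda, since the interval matrices are
  taken over P(z). Over the convex strip of lifts they become global without loss in the
  constant.\<close>

section \<open>A covering lemma from Brouwer's theorem\<close>

text \<open>At \<open>t = 1\<close> the only zero of (X, Y) is x = 0, because \<open>A\<close> is
  injective. \<open>side\<close> and \<open>avoid\<close> keep the part of the cylinder mapped into
  the block away from the lateral boundary and from norm Y = R, so this solution should persist down
  to \<open>t = 0\<close>. A fixed point of a map of the cylinder into itself replaces the degree
  argument.\<close>

lemma covering_disc: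
  fixes X :: "real \<times> 'a::euclidean_space \<Rightarrow> 'a" and Y :: "real \<times> 'a \<Rightarrow> 'b::real_normed_vector"
  assumes R: "0 < R"
    and contX: "continuous_on ({0..1} \<times> cball 0 R) X"
    and contY: "continuous_on ({0..1} \<times> cball 0 R) Y"
    and side: "\<And>t x. t \<in> {0..1} \<Longrightarrow> norm x = R \<Longrightarrow> norm (X (t, x)) \<le> R \<Longrightarrow> R < norm (Y (t, x))"
    and avoid: "\<And>t x. t \<in> {0..1} \<Longrightarrow> norm x \<le> R \<Longrightarrow> norm (X (t, x)) \<le> R \<Longrightarrow> norm (Y (t, x)) \<noteq> R"
    and X1: "\<And>x. norm x \<le> R \<Longrightarrow> X (1, x) = A x" and Y1: "\<And>x. norm x \<le> R \<Longrightarrow> Y (1, x) = 0"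
    and A: "linear A" "\<And>x. norm x = R \<Longrightarrow> R < norm (A x)"
  shows "\<exists>x. norm x \<le> R \<and> norm (X (0, x)) \<le> R \<and> norm (Y (0, x)) \<le> R"
proof (rule ccontr)
  assume contra: "\<not> ?thesis"
  define C where "C = {0..1::real} \<times> cball (0::'a) R"
  define V where "V = {p \<in> C. norm (X p) \<le> R \<and> norm (Y p) \<le> R}"
  define V' where "V' = {p \<in> C. R \<le> norm (X p) \<or> R \<le> norm (Y p)}"
  have C: "compact C" "convex C" "closed C" "C \<noteq> {}"
    unfolding C_def using R
    by (auto intro!: compact_Times convex_Times closed_Times)
  have cX: "continuous_on C X" and cY: "continuous_on C Y"
    using contX contY by (auto simp: C_def)
  have V: "closed V"
  proof -
    have "V = (C \<inter> (\<lambda>p. norm (X p)) -` {..R}) \<inter> (C \<inter> (\<lambda>p. norm (Y p)) -` {..R})"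
      by (auto simp: V_def)
    thus ?thesis
      by (simp only:) (intro closed_Int continuous_closed_preimage continuous_on_norm cX cY C(3) closed_atMost)
  qed
  have V': "closed V'"
  proof -
    have "V' = (C \<inter> (\<lambda>p. norm (X p)) -` {R..}) \<union> (C \<inter> (\<lambda>p. norm (Y p)) -` {R..})"
      by (auto simp: V'_def)
    thus ?thesis
      by (simp only:) (intro closed_Un continuous_closed_preimage continuous_on_norm cX cY C(3) closed_atLeast)
  qed
  have VV': "V \<union> V' = C" by (auto simp: V_def V'_def)
  \<comment> \<open>On the overlap \<open>avoid\<close> excludes norm Y = R, which leaves norm X =
    R. There the two branches of \<open>Gx\<close> (both 0) and of \<open>Ga\<close> (both -R/2)
    agree, so both functions are continuous.\<close>
  have VintV': "norm (X p) = R" if "p \<in> V" "p \<in> V'" for p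
    using that avoid[of "fst p" "snd p"] by (force simp: V_def V'_def C_def)
  text \<open>
    Collapsing the complement of the block to one point turns (X, Y) into the nowhere vanishing field
    (Gx, Ga).  On the top of the cylinder C it has the degree of A, on the rest of the boundary it is
    constant; T is built from it so that a fixed point would be a zero.
  \<close>
  define Gx where "Gx p = (if p \<in> V then (R - norm (X p)) *\<^sub>R X p else 0)" for p
  define Ga where "Ga p = (if p \<in> V then R/2 - norm (X p) else - R/2)" for p
  have cXV: "continuous_on V X" using cX by (rule continuous_on_subset) (auto simp: V_def)
  have "continuous_on (V \<union> V') Gx" unfolding Gx_def
    by (rule continuous_on_cases[OF V V'])
       (use cXV VintV' in \<open>auto intro!: continuous_intros\<close>)
  hence cGx: "continuous_on C Gx" by (simp add: VV')
  have "continuous_on (V \<union> V') Ga" unfolding Ga_def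
    by (rule continuous_on_cases[OF V V'])
       (use cXV VintV' in \<open>auto intro!: continuous_intros\<close>)
  hence cGa: "continuous_on C Ga" by (simp add: VV')
  have A0: "x = 0" if "A x = 0" for x
  proof (rule ccontr)
    assume x: "x \<noteq> 0"
    have "R < norm (A ((R / norm x) *\<^sub>R x))" using x R by (intro A(2)) auto
    also have "A ((R / norm x) *\<^sub>R x) = 0" using that A(1) by (simp add: linear_scale)
    finally show False using R by simp
  qed
  have "inj A" using A0 A(1) by (simp add: linear_injective_0)
  then obtain B where B: "linear B" "\<And>x. B (A x) = x" "\<And>x. A (B x) = x"
    using linear_injective_isomorphism[OF A(1)] by auto
  \<comment> \<open>\<open>B\<close> straightens \<open>A\<close>, so that on the top of the
    cylinder \<open>- B (Gx p)\<close> is a nonpositive multiple of x. The second term makes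
    \<open>w\<close> point inward there also where \<open>Gx\<close> vanishes. Clipping in the first
    component of \<open>T\<close> forces Ga \<ge> 0 at t = 0, Ga \<le> 0 at t = 1 and Ga = 0 in
    between.\<close>
  define w where "w p = - B (Gx p) - max 0 (- Ga p) *\<^sub>R snd p" for p
  define T where "T p = (max 0 (min 1 (fst p - Ga p)), closest_point (cball 0 R) (snd p + w p))" for p
  have cB: "continuous_on UNIV B" using B(1) by (simp add: linear_continuous_on linear_linear)
  have cw: "continuous_on C w" unfolding w_def
    by (intro continuous_intros cGx cGa continuous_on_compose2[OF cB cGx]) auto
  have "continuous_on C T" unfolding T_def
  proof (intro continuous_intros cGa)
    show "continuous_on C (\<lambda>p. closest_point (cball 0 R) (snd p + w p))"
      by (rule continuous_on_compose2[OF continuous_on_closest_point])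
         (use R in \<open>auto intro!: continuous_intros cw\<close>)
  qed
  moreover have "T \<in> C \<rightarrow> C" using R closest_point_in_set[of "cball (0::'a) R"]
    by (auto simp: T_def C_def)
  ultimately obtain p where p: "p \<in> C" "T p = p"
    using brouwer[OF C(1,2,4), of T] by auto
  obtain t x where tx: "p = (t, x)" by (cases p)
  have t: "0 \<le> t" "t \<le> 1" and x: "norm x \<le> R" using p(1) by (auto simp: C_def tx)
  have ft: "max 0 (min 1 (t - Ga p)) = t" and fx: "closest_point (cball 0 R) (x + w p) = x"
    using p(2) by (auto simp: T_def tx)
  \<comment> \<open>The variational inequality for the projection onto the disc: at a fixed point
    \<open>w p\<close> is an outward normal to the disc at x, hence 0 if x is interior.\<close>
  have dot: "w p \<bullet> (y - x) \<le> 0" if "norm y \<le> R" for y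
    using closest_point_dot[of "cball 0 R" y "x + w p"] that fx R by auto
  consider "t = 0" | "t = 1" | "0 < t" "t < 1" using t by linarith
  thus False
  proof cases
    case 1
    hence "p \<notin> V" using contra x by (auto simp: V_def tx)
    hence "Ga p = - R/2" by (simp add: Ga_def)
    thus False using ft 1 R by auto
  next
    case 2
    have Ga: "Ga p \<le> 0" using ft 2 by (auto simp: max_def min_def split: if_splits)
    have Xp: "X p = A x" using X1 x 2 tx by simp
    have pV: "p \<in> V \<longleftrightarrow> norm (A x) \<le> R" using Y1 x 2 tx R Xp p(1) by (auto simp: V_def)
    have "x \<noteq> 0"
      using Ga R pV Xp A(1) by (auto simp: Ga_def linear_0 split: if_splits)
    moreover have "\<exists>s>0. w p = - s *\<^sub>R x"
    proof (cases "p \<in> V \<and> norm (A x) < R")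
      case True
      hence "Gx p = (R - norm (A x)) *\<^sub>R A x" by (simp add: Gx_def Xp)
      hence "B (Gx p) = (R - norm (A x)) *\<^sub>R x" by (simp only: linear_scale[OF B(1)] B(2))
      hence "w p = - (R - norm (A x) + max 0 (- Ga p)) *\<^sub>R x"
        by (simp add: w_def tx algebra_simps)
      moreover have "R - norm (A x) + max 0 (- Ga p) > 0" using True by auto
      ultimately show ?thesis by blast
    next
      case False
      hence "Gx p = 0" "Ga p < 0" using R pV Xp
        by (auto simp: Gx_def Ga_def)
      hence "w p = - (- Ga p) *\<^sub>R x" "- Ga p > 0"
        using B(1) by (simp_all add: w_def tx linear_0)
      thus ?thesis by blast
    qed
    ultimately show False using dot[of 0] R by (auto simp: mult_le_0_iff inner_gt_zero_iff[symmetric] simp del: inner_gt_zero_iff)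
  next
    case 3
    hence Ga: "Ga p = 0" using ft by (auto simp: max_def min_def split: if_splits)
    hence pV: "p \<in> V" using R by (auto simp: Ga_def split: if_splits)
    hence nX: "norm (X p) = R/2" using Ga by (auto simp: Ga_def)
    have "norm x \<noteq> R" using side[of t x] pV t by (auto simp: V_def tx)
    hence xR: "norm x < R" using x by simp
    have "R - norm (X p) = R/2" using nX by simp
    hence "Gx p = (R/2) *\<^sub>R X p" using pV unfolding Gx_def by (simp only: if_True)
    hence w: "w p = - B ((R/2) *\<^sub>R X p)" using Ga by (simp add: w_def)
    have "w p = 0"
    proof -
      \<comment> \<open>A step so short that x + s w stays in the disc and may be inserted in
        \<open>dot\<close>; the added 1 keeps the denominator positive.\<close>
      define s where "s = (R - norm x) / (1 + norm (w p))"
      have s: "0 < s" "s * (1 + norm (w p)) = R - norm x"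
        using xR add_pos_nonneg[OF zero_less_one norm_ge_zero, of "w p"] by (auto simp: s_def)
      have "norm (x + s *\<^sub>R w p) \<le> norm x + s * norm (w p)"
        using norm_triangle_ineq[of x "s *\<^sub>R w p"] s(1) by simp
      also have "\<dots> \<le> R" using s by (simp add: algebra_simps)
      finally have "s * (w p \<bullet> w p) \<le> 0" using dot[of "x + s *\<^sub>R w p"] by simp
      thus ?thesis using s(1) by (metis inner_gt_zero_iff mult_pos_pos not_le)
    qed
    hence "(R/2) *\<^sub>R X p = 0" using w B(3) A(1) by (metis linear_0 neg_equal_0_iff_equal)
    thus False using nX R by auto
  qed
qed

section \<open>Lattice translations and coordinates\<close>

lemma Zlat_0 [simp]: "0 \<in> Zlat" by (simp add: Zlat_def)

lemma Zlat_add: "m \<in> Zlat \<Longrightarrow> n \<in> Zlat \<Longrightarrow> m + n \<in> Zlat" by (simp add: Zlat_def)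

lemma Zlat_uminus: "m \<in> Zlat \<Longrightarrow> - m \<in> Zlat" by (simp add: Zlat_def)

lemma Zlat_diff: "m \<in> Zlat \<Longrightarrow> n \<in> Zlat \<Longrightarrow> m - n \<in> Zlat" by (simp add: Zlat_def)

lemma closed_Zlat: "closed (Zlat :: (real^'c::finite) set)"
proof -
  have "closed ((\<lambda>l::real^'c. l $ i) -` (\<int> :: real set))" for i
    by (intro closed_vimage continuous_intros closed_Ints)
  moreover have "(Zlat :: (real^'c) set) = (\<Inter>i. (\<lambda>l. l $ i) -` \<int>)" by (auto simp: Zlat_def)
  ultimately show ?thesis by (metis (no_types) closed_INT)
qed

lemma Zlat_unit_cube:
  fixes l :: "real^'c::finite"
  obtains n where "n \<in> Zlat" "l + n \<in> cbox 0 1"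
proof
  show "(\<chi> i. - of_int \<lfloor>l $ i\<rfloor>) \<in> Zlat" by (simp add: Zlat_def)
  show "l + (\<chi> i. - of_int \<lfloor>l $ i\<rfloor>) \<in> cbox 0 1"
    by (auto simp: mem_box_cart) (linarith)+
qed

text \<open>The lattice is discrete, coordinate by coordinate with gap 1. This will show that a lift
  commutes with a translation up to one lattice vector, the same for all points.\<close>

lemma continuous_Zlat_constant:
  fixes g :: "'a::topological_space \<Rightarrow> real^'c::finite"
  assumes "connected S" "continuous_on S g" "\<And>x. x \<in> S \<Longrightarrow> g x \<in> Zlat"
  obtains m where "\<And>x. x \<in> S \<Longrightarrow> g x = m"
proof -
  have "(\<lambda>x. g x $ i) constant_on S" for i
  proof (rule continuous_discrete_range_constant[OF assms(1)])
    show "continuous_on S (\<lambda>x. g x $ i)" using assms(2) by (intro continuous_intros)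
    show "\<exists>e>0. \<forall>y. y \<in> S \<and> g y $ i \<noteq> g x $ i \<longrightarrow> e \<le> norm (g y $ i - g x $ i)" if "x \<in> S" for x
    proof (intro exI[of _ 1] conjI allI impI)
      fix y assume y: "y \<in> S \<and> g y $ i \<noteq> g x $ i"
      hence "g y $ i - g x $ i \<in> \<int>" "g y $ i - g x $ i \<noteq> 0"
        using assms(3) that by (auto simp: Zlat_def)
      thus "1 \<le> norm (g y $ i - g x $ i)" by (simp add: Ints_nonzero_abs_ge1)
    qed simp
  qed
  then obtain m where "\<And>i x. x \<in> S \<Longrightarrow> g x $ i = m i"
    unfolding constant_on_def by metis
  hence "g x = (\<chi> i. m i)" if "x \<in> S" for x using that by (simp add: vec_eq_iff)
  thus ?thesis by (rule that)
qed

text \<open>Splits phase space into the base (lambda, x) and the fibre y, the splitting over which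
  the centre-unstable graphs live.\<close>

definition mk :: "(real^'c) \<times> (real^'u) \<Rightarrow> real^'s \<Rightarrow> ('c::finite,'u::finite,'s::finite) st" where
  "mk q y = (fst q, snd q, y)"

text \<open>For lattice vectors \<open>n\<close> these are the deck transformations of the covering
  of the torus by its lifts.\<close>

definition tr :: "real^'c \<Rightarrow> ('c::finite,'u::finite,'s::finite) st \<Rightarrow> ('c,'u,'s) st" where
  "tr n z = z + (n, 0, 0)"

lemma mk_simps [simp]:
  "pl (mk q y) = fst q" "px (mk q y) = snd q" "py (mk q y) = y" "plx (mk q y) = q"
  "mk (plx z) (py z) = z"
  by (simp_all add: mk_def pl_def px_def py_def plx_def)

lemma tr_simps [simp]:
  "pl (tr n z) = pl z + n" "px (tr n z) = px z" "py (tr n z) = py z" "plx (tr n z) = plx z + (n, 0)"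
  "tr 0 z = z" "tr m (tr n z) = tr (n + m) z" "tr n (mk q y) = mk (q + (n, 0)) y"
  by (simp_all add: tr_def mk_def pl_def px_def py_def plx_def prod_eq_iff)

lemma plx_proj [simp]: "fst (plx z) = pl z" "snd (plx z) = px z"
  by (simp_all add: plx_def)

lemma st_eqI: "plx z = plx w \<Longrightarrow> py z = py w \<Longrightarrow> z = w"
  by (metis mk_simps(5))

lemma proj_diff:
  "pl (z - w) = pl z - pl w" "px (z - w) = px z - px w" "py (z - w) = py z - py w"
  "plx (z - w) = plx z - plx w"
  "pl (z + w) = pl z + pl w" "px (z + w) = px z + px w" "py (z + w) = py z + py w"
  "plx (z + w) = plx z + plx w"
  "pl (t *\<^sub>R w) = t *\<^sub>R pl w" "px (t *\<^sub>R w) = t *\<^sub>R px w" "py (t *\<^sub>R w) = t *\<^sub>R py w"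
  "plx (t *\<^sub>R w) = t *\<^sub>R plx w"
  by (simp_all add: pl_def px_def py_def plx_def)

lemma bounded_linear_proj:
  "bounded_linear (pl :: ('c::finite,'u::finite,'s::finite) st \<Rightarrow> _)"
  "bounded_linear (px :: ('c::finite,'u::finite,'s::finite) st \<Rightarrow> _)"
  "bounded_linear (py :: ('c::finite,'u::finite,'s::finite) st \<Rightarrow> _)"
  "bounded_linear (plx :: ('c::finite,'u::finite,'s::finite) st \<Rightarrow> _)"
  "bounded_linear (elx :: _ \<Rightarrow> ('c::finite,'u::finite,'s::finite) st)"
  "bounded_linear (ey :: _ \<Rightarrow> ('c::finite,'u::finite,'s::finite) st)"
  by (auto intro!: linear_conv_bounded_linear[THEN iffD1] linearI
      simp: pl_def px_def py_def plx_def elx_def ey_def)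

lemma mk_eq: "mk q y = elx q + ey y"
  by (simp add: mk_def elx_def ey_def)

lemmas continuous_on_proj [continuous_intros] =
  bounded_linear.continuous_on[OF bounded_linear_proj(1)]
  bounded_linear.continuous_on[OF bounded_linear_proj(2)]
  bounded_linear.continuous_on[OF bounded_linear_proj(3)]
  bounded_linear.continuous_on[OF bounded_linear_proj(4)]

lemma continuous_on_mk [continuous_intros]:
  "continuous_on S q \<Longrightarrow> continuous_on S y \<Longrightarrow> continuous_on S (\<lambda>t. mk (q t) (y t))"
  unfolding mk_def by (intro continuous_intros)

lemma norm_proj_le: "norm (plx z) \<le> norm z" "norm (py z) \<le> norm z"
  by (auto simp: norm_prod_def plx_def pl_def px_def py_def intro!: real_le_rsqrt)

lemma eqv_iff_tr: "eqv z w \<longleftrightarrow> (\<exists>n\<in>Zlat. z = tr n w)"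
proof
  assume "eqv z w"
  hence "pl z - pl w \<in> Zlat" "z = tr (pl z - pl w) w"
    by (auto simp: eqv_def tr_def pl_def px_def py_def prod_eq_iff)
  thus "\<exists>n\<in>Zlat. z = tr n w" by blast
qed (auto simp: eqv_def)

lemma eqv_refl [simp]: "eqv z z" by (simp add: eqv_def)

lemma eqv_sym: "eqv z w \<Longrightarrow> eqv w z"
  unfolding eqv_def using Zlat_uminus by force

lemma eqv_trans: "eqv z w \<Longrightarrow> eqv w v \<Longrightarrow> eqv z v"
  unfolding eqv_def by (auto dest: Zlat_add)

lemma eqv_tr: "n \<in> Zlat \<Longrightarrow> eqv (tr n z) z"
  by (auto simp: eqv_iff_tr)

lemma eqv_Dset: "eqv z w \<Longrightarrow> z \<in> Dset R \<longleftrightarrow> w \<in> Dset R"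
  by (auto simp: eqv_def Dset_def)

lemma tr_Dset [simp]: "tr n z \<in> Dset R \<longleftrightarrow> z \<in> Dset R"
  by (simp add: Dset_def)

lemma in_Js_eqv:
  assumes "eqv z z'" "eqv w w'" "in_Js z M w"
  shows "in_Js z' M w'"
proof -
  obtain a where a: "a \<in> Zlat" "z = tr a z'" using assms(1) by (auto simp: eqv_iff_tr)
  obtain b where b: "b \<in> Zlat" "w = tr b w'" using assms(2) by (auto simp: eqv_iff_tr)
  obtain n where n: "n \<in> Zlat" "norm (pl w + n - pl z) \<le> RLam"
      "norm ((pl w + n - pl z, px w - px z)) \<le> M * norm (py w - py z)"
    using assms(3) by (auto simp: in_Js_def)
  have "pl w' + (b + n - a) - pl z' = pl w + n - pl z" by (simp add: a(2) b(2))
  moreover have "b + n - a \<in> Zlat" using a b n by (simp add: Zlat_add Zlat_diff)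
  ultimately show ?thesis using n(2,3) a(2) b(2) unfolding in_Js_def by (metis tr_simps(2,3))
qed

lemma convex_Dset: "convex (Dset R :: ('c::finite,'u::finite,'s::finite) st set)"
proof -
  have "(Dset R :: ('c,'u,'s) st set) = UNIV \<times> cball 0 R \<times> cball 0 R"
    by (auto simp: Dset_def px_def py_def)
  thus ?thesis by (simp add: convex_Times)
qed

lemma closed_Dset: "closed (Dset R :: ('c::finite,'u::finite,'s::finite) st set)"
proof -
  have "(Dset R :: ('c,'u,'s) st set) = UNIV \<times> cball 0 R \<times> cball 0 R"
    by (auto simp: Dset_def px_def py_def)
  thus ?thesis by (simp add: closed_Times)
qed

text \<open>A compact set meeting every lattice orbit in \<open>Dset R\<close>. Lifts make D
  unbounded, so each compactness argument passes through this set.\<close>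

definition Kset :: "real \<Rightarrow> ('c::finite,'u::finite,'s::finite) st set" where
  "Kset R = cbox 0 1 \<times> cball 0 R \<times> cball 0 R"

lemma compact_Kset: "compact (Kset R)"
  by (simp add: Kset_def compact_Times)

lemma Kset_subset: "Kset R \<subseteq> Dset R"
  by (auto simp: Kset_def Dset_def px_def py_def)

lemma Kset_representative:
  assumes "z \<in> Dset R"
  obtains n where "n \<in> Zlat" "tr n z \<in> Kset R"
proof -
  obtain n where "n \<in> Zlat" "pl z + n \<in> cbox 0 1" by (rule Zlat_unit_cube)
  thus ?thesis using assms that[of n] by (cases z) (auto simp: Kset_def Dset_def tr_def pl_def px_def py_def)
qed

lemma mk_Dset [simp]: "mk q y \<in> Dset R \<longleftrightarrow> norm (snd q) \<le> R \<and> norm y \<le> R"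
  by (simp add: Dset_def)

section \<open>Estimates from the derivative\<close>

text \<open>The set under the \<open>Sup\<close> contains 0 and is bounded above by the norm of the
  image of any basis vector, so the supremum is a genuine one and is itself admissible.\<close>

lemma mnorm_bounds:
  fixes A :: "'a::euclidean_space \<Rightarrow> 'b::real_normed_vector"
  shows "0 \<le> mnorm A" "mnorm A * norm v \<le> norm (A v)"
proof -
  let ?S = "{c. \<forall>v. c * norm v \<le> norm (A v)}"
  obtain b :: 'a where "b \<in> Basis" by (metis nonempty_Basis all_not_in_conv)
  hence "c \<le> norm (A b)" if "c \<in> ?S" for c using that by (force dest: spec[of _ b])
  hence bdd: "bdd_above ?S" by (auto simp: bdd_above_def)
  have "0 \<in> ?S" by simp
  thus "0 \<le> mnorm A" unfolding mnorm_def using bdd by (rule cSup_upper)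
  show "mnorm A * norm v \<le> norm (A v)"
  proof (cases "v = 0")
    case False
    have "mnorm A \<le> norm (A v) / norm v" unfolding mnorm_def
    proof (rule cSup_least)
      show "c \<le> norm (A v) / norm v" if "c \<in> ?S" for c using that False by (simp add: field_simps)
      show "?S \<noteq> {}" using \<open>0 \<in> ?S\<close> by blast
    qed
    thus ?thesis using False by (simp add: field_simps)
  qed simp
qed

lemma mset_lower:
  fixes A :: "'a::euclidean_space \<Rightarrow> 'b::real_normed_vector"
  assumes "A \<in> As"
  shows "0 \<le> mset As" "mset As * norm v \<le> norm (A v)"
proof -
  have "mset As \<le> mnorm A" unfolding mset_def
    by (rule cInf_lower) (use assms mnorm_bounds(1) in \<open>auto simp: bdd_below_def\<close>)
  hence "mset As * norm v \<le> mnorm A * norm v" by (simp add: mult_right_mono)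
  also have "\<dots> \<le> norm (A v)" by (rule mnorm_bounds)
  finally show "mset As * norm v \<le> norm (A v)" .
  show "0 \<le> mset As" unfolding mset_def
    by (rule cInf_greatest) (use assms mnorm_bounds(1) in auto)
qed

locale torus_lift =
  fixes F :: "('c::finite,'u::finite,'s::finite) st \<Rightarrow> ('c,'u,'s) st" and R :: real
  assumes R_pos: "0 < R"
    and lift: "is_torus_lift F R"
    and der: "\<And>z. z \<in> Dset R \<Longrightarrow> (F has_derivative DF F z) (at z)"
    and cont_DF: "\<And>v. continuous_on (Dset R) (\<lambda>z. DF F z v)"
begin

lemma lift_tr: "z \<in> Dset R \<Longrightarrow> n \<in> Zlat \<Longrightarrow> eqv (F (tr n z)) (F z)"
proof -
  assume "z \<in> Dset R" "n \<in> Zlat"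
  moreover have "tr n z = (pl z + n, px z, py z)" by (simp add: tr_def pl_def px_def py_def prod_eq_iff)
  ultimately show ?thesis using lift by (simp add: is_torus_lift_def)
qed

lemma lift_eqv: "z \<in> Dset R \<Longrightarrow> eqv w z \<Longrightarrow> eqv (F w) (F z)"
  unfolding eqv_iff_tr[of w] using lift_tr by blast

lemma cont_F: "continuous_on (Dset R) F"
  by (rule has_derivative_continuous_on[of _ _ "DF F"]) (use der has_derivative_at_withinI in blast)

lemma linear_DF: "z \<in> Dset R \<Longrightarrow> linear (DF F z)"
  using der has_derivative_linear by blast

lemma zero_in_Dset: "0 \<in> Dset R"
  using R_pos by (simp add: Dset_def px_def py_def)

text \<open>\<open>F\<close> composed with \<open>tr n\<close> differs from \<open>F\<close> by a
  constant lattice vector, but only on D. An interior point has a neighbourhood on which this can be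
  differentiated; a boundary point is reached by continuity along the radial path that scales x and
  y by t < 1.\<close>

lemma DF_tr:
  assumes n: "n \<in> Zlat" and z: "z \<in> Dset R"
  shows "DF F (tr n z) v = DF F z v"
proof -
  have cont_tr: "continuous_on S (tr n :: ('c,'u,'s) st \<Rightarrow> _)" for S
    unfolding tr_def by (intro continuous_intros)
  have cFt: "continuous_on (Dset R) (\<lambda>z. F (tr n z))"
    by (rule continuous_on_compose2[OF cont_F cont_tr]) auto
  obtain m where m: "\<And>z. z \<in> Dset R \<Longrightarrow> pl (F (tr n z)) - pl (F z) = m"
  proof (rule continuous_Zlat_constant[of "Dset R" "\<lambda>z. pl (F (tr n z)) - pl (F z)"])
    show "connected (Dset R :: ('c,'u,'s) st set)" using convex_Dset convex_connected by blast
    show "continuous_on (Dset R) (\<lambda>z. pl (F (tr n z)) - pl (F z))"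
      by (intro continuous_intros cFt cont_F)
    show "pl (F (tr n z)) - pl (F z) \<in> Zlat" if "z \<in> Dset R" for z
      using lift_tr[OF that n] by (simp add: eqv_def)
  qed blast
  have FT: "F (tr n z) = tr m (F z)" if "z \<in> Dset R" for z
    using m[OF that] lift_tr[OF that n] by (intro st_eqI) (auto simp: eqv_def prod_eq_iff)
  have inner: "DF F (tr n z) v = DF F z v" if z: "norm (px z) < R" "norm (py z) < R" for z
  proof -
    have zD: "z \<in> Dset R" using z by (simp add: Dset_def)
    let ?O = "{z::('c,'u,'s) st. norm (px z) < R} \<inter> {z. norm (py z) < R}"
    have op: "open ?O"
      by (intro open_Int open_Collect_less continuous_intros)
    have "((\<lambda>w. F (w + (n,0,0)) - (m,0,0)) has_derivative DF F (tr n z)) (at z)"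
    proof -
      have "(F has_derivative DF F (tr n z)) (at (tr n z))"
        using zD by (intro der) simp
      hence "(F has_derivative DF F (tr n z)) (at (z + (n,0,0)))"
        by (simp only: tr_def)
      hence "((\<lambda>w. F (w + (n,0,0))) has_derivative (\<lambda>v. DF F (tr n z) v)) (at z)"
        by (intro has_derivative_compose[where f="\<lambda>w. w + (n,0,0)" and f'="\<lambda>v. v" and g=F])
          (auto intro!: derivative_eq_intros)
      thus ?thesis by (auto intro!: derivative_eq_intros)
    qed
    hence "(F has_derivative DF F (tr n z)) (at z)"
      by (rule has_derivative_transform_within_open[OF _ op])
         (use z FT in \<open>auto simp: tr_def Dset_def\<close>)
    thus ?thesis using der[OF zD] has_derivative_unique by metis
  qed
  define p where "p t = mk (pl z, t *\<^sub>R px z) (t *\<^sub>R py z)" for t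
  have pD: "p t \<in> Dset R" if "t \<in> {0..1}" for t
    using that z mult_left_le_one_le[of "norm (px z)" t] mult_left_le_one_le[of "norm (py z)" t]
    by (auto simp: p_def Dset_def)
  have pI: "norm (px (p t)) < R \<and> norm (py (p t)) < R" if "t \<in> {0..<1}" for t
  proof -
    have "t * norm (px z) \<le> t * R" "t * norm (py z) \<le> t * R" "t * R < 1 * R"
      using that z R_pos by (auto simp: Dset_def intro!: mult_left_mono)
    thus ?thesis using that by (auto simp: p_def)
  qed
  have cp: "continuous_on {0..1} p" unfolding p_def by (intro continuous_intros)
  have "DF F (tr n (p 1)) v - DF F (p 1) v = 0"
  proof (rule continuous_constant_on_closure[of "{0..<1::real}" "\<lambda>t. DF F (tr n (p t)) v - DF F (p t) v"])
    have cl: "closure {0..<1::real} = {0..1}" by (simp add: closure_atLeastLessThan)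
    have "continuous_on {0..1} (\<lambda>t. tr n (p t))" using cp unfolding tr_def by (intro continuous_intros)
    thus "continuous_on (closure {0..<1}) (\<lambda>t. DF F (tr n (p t)) v - DF F (p t) v)"
      unfolding cl using pD cp
      by (intro continuous_intros continuous_on_compose2[OF cont_DF]) auto
    show "DF F (tr n (p t)) v - DF F (p t) v = 0" if "t \<in> {0..<1}" for t
      using inner[of "p t"] pI[OF that] by simp
    show "1 \<in> closure {0..<1::real}" by (simp add: cl)
  qed
  moreover have "p 1 = z" by (intro st_eqI) (simp_all add: p_def plx_def)
  ultimately show ?thesis by simp
qed

text \<open>Continuity bounds each basis direction on the compact \<open>Kset R\<close>, and
  periodicity carries the bound to all of D. It is what makes the real-valued suprema in the rate
  constants meaningful.\<close>

lemma DF_bounded: "\<exists>B\<ge>0. \<forall>z\<in>Dset R. \<forall>v. norm (DF F z v) \<le> B * norm v"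
proof -
  have "\<exists>B. \<forall>z\<in>Kset R. norm (DF F z b) \<le> B" for b
  proof -
    have "compact ((\<lambda>z. DF F z b) ` Kset R)"
      by (intro compact_continuous_image continuous_on_subset[OF cont_DF Kset_subset] compact_Kset)
    from compact_imp_bounded[OF this] show ?thesis by (auto simp: bounded_iff)
  qed
  then obtain B where B: "\<And>b z. z \<in> Kset R \<Longrightarrow> norm (DF F z b) \<le> B b" by metis
  have "norm (DF F z v) \<le> (\<Sum>b\<in>Basis. \<bar>B b\<bar>) * norm v" if z: "z \<in> Dset R" for z v
  proof -
    obtain n where n: "n \<in> Zlat" "tr n z \<in> Kset R" using Kset_representative[OF z] .
    have "DF F z v = DF F z (\<Sum>b\<in>Basis. (v \<bullet> b) *\<^sub>R b)" by (simp add: euclidean_representation)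
    also have "\<dots> = (\<Sum>b\<in>Basis. (v \<bullet> b) *\<^sub>R DF F z b)"
      using linear_DF[OF z] by (simp add: linear_sum linear_scale)
    finally have "norm (DF F z v) = norm (\<Sum>b\<in>Basis. (v \<bullet> b) *\<^sub>R DF F z b)" by simp
    also have "\<dots> \<le> (\<Sum>b\<in>Basis. \<bar>B b\<bar> * norm v)"
    proof (rule sum_norm_le)
      fix b :: "('c,'u,'s) st" assume "b \<in> Basis"
      have "norm (DF F z b) \<le> \<bar>B b\<bar>" using B[OF n(2), of b] DF_tr[OF n(1) z, of b] by simp
      thus "norm ((v \<bullet> b) *\<^sub>R DF F z b) \<le> \<bar>B b\<bar> * norm v"
        using Basis_le_norm[OF \<open>b \<in> Basis\<close>, of v] by (simp add: mult_mono mult.commute)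
    qed
    finally show ?thesis by (simp add: sum_distrib_right)
  qed
  thus ?thesis by (intro exI[of _ "\<Sum>b\<in>Basis. \<bar>B b\<bar>"]) (auto intro: sum_nonneg)
qed

end

lemma norm_embed [simp]: "norm (ey v) = norm v" "norm (elx q) = norm q"
  by (simp_all add: ey_def elx_def norm_prod_def)

context torus_lift begin

lemma bounded_linear_DF: "z \<in> Dset R \<Longrightarrow> bounded_linear (DF F z)"
  using linear_DF by (simp add: linear_conv_bounded_linear)

lemma bounded_linear_blocks:
  assumes "z \<in> Dset R"
  shows "bounded_linear (dyfy F z)" "bounded_linear (dlxfy F z)" "bounded_linear (dyflx F z)"
    "bounded_linear (dlxflx F z)"
  unfolding dyfy_def dlxfy_def dyflx_def dlxflx_def comp_def
  by (fact bounded_linear_compose[OF bounded_linear_proj(3) bounded_linear_compose[OF bounded_linear_DF[OF assms] bounded_linear_proj(6)]]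
      bounded_linear_compose[OF bounded_linear_proj(3) bounded_linear_compose[OF bounded_linear_DF[OF assms] bounded_linear_proj(5)]]
      bounded_linear_compose[OF bounded_linear_proj(4) bounded_linear_compose[OF bounded_linear_DF[OF assms] bounded_linear_proj(6)]]
      bounded_linear_compose[OF bounded_linear_proj(4) bounded_linear_compose[OF bounded_linear_DF[OF assms] bounded_linear_proj(5)]])+

lemma blocks_bounded:
  obtains B where "0 \<le> B"
    "\<And>z v. z \<in> Dset R \<Longrightarrow> norm (dyfy F z v) \<le> B * norm v"
    "\<And>z v. z \<in> Dset R \<Longrightarrow> norm (dlxfy F z v) \<le> B * norm v"
    "\<And>z v. z \<in> Dset R \<Longrightarrow> norm (dyflx F z v) \<le> B * norm v"
    "\<And>z v. z \<in> Dset R \<Longrightarrow> norm (dlxflx F z v) \<le> B * norm v"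
proof -
  obtain B where B: "0 \<le> B" "\<And>z v. z \<in> Dset R \<Longrightarrow> norm (DF F z v) \<le> B * norm v"
    using DF_bounded by blast
  show ?thesis
    by (rule that[OF B(1)]; unfold dyfy_def dlxfy_def dyflx_def dlxflx_def comp_def;
        rule order_trans[OF norm_proj_le(1)] order_trans[OF norm_proj_le(2)];
        rule order_trans[OF B(2)]; simp)
qed

lemma onorm_blocks_bounded:
  obtains B where "0 \<le> B"
    "\<And>z. z \<in> Dset R \<Longrightarrow> onorm (dyfy F z) \<le> B"
    "\<And>z. z \<in> Dset R \<Longrightarrow> onorm (dlxfy F z) \<le> B"
    "\<And>z. z \<in> Dset R \<Longrightarrow> onorm (dyflx F z) \<le> B"
proof (rule blocks_bounded)
  fix B
  assume B: "0 \<le> B"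
    "\<And>z v. z \<in> Dset R \<Longrightarrow> norm (dyfy F z v) \<le> B * norm v"
    "\<And>z v. z \<in> Dset R \<Longrightarrow> norm (dlxfy F z v) \<le> B * norm v"
    "\<And>z v. z \<in> Dset R \<Longrightarrow> norm (dyflx F z v) \<le> B * norm v"
  show ?thesis
    by (rule that[OF B(1) onorm_bound[OF B(1)] onorm_bound[OF B(1)] onorm_bound[OF B(1)]]) (fact B)+
qed

lemma mu_s1_upper:
  assumes K: "0 < K" and z: "z \<in> Dset R"
  shows "onorm (dyfy F z) + 1/K * onorm (dlxfy F z) \<le> mu_s1 F R K"
  unfolding mu_s1_def
proof (rule cSUP_upper[OF z])
  obtain B where B: "\<And>z. z \<in> Dset R \<Longrightarrow> onorm (dyfy F z) \<le> B"
    "\<And>z. z \<in> Dset R \<Longrightarrow> onorm (dlxfy F z) \<le> B"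
    using onorm_blocks_bounded by metis
  show "bdd_above ((\<lambda>z. onorm (dyfy F z) + 1/K * onorm (dlxfy F z)) ` Dset R)"
    by (rule bdd_aboveI[of _ "B + 1/K * B"])
       (use K in \<open>auto intro!: add_mono divide_right_mono B\<close>)
qed

lemma mu_s1_nonneg: "0 < K \<Longrightarrow> 0 \<le> mu_s1 F R K"
  by (rule order_trans[OF _ mu_s1_upper[OF _ zero_in_Dset]])
     (auto intro!: add_nonneg_nonneg divide_nonneg_pos onorm_pos_le bounded_linear_blocks zero_in_Dset)

text \<open>The mean value inequality along the segment in the convex set D, with the direction
  split into its (lambda, x) and y parts. \<open>C\<close> bounds the weighted sum at each single
  point, since the rates are suprema of such sums and not sums of suprema.\<close>

lemma fy_bound:
  assumes z: "z1 \<in> Dset R" "z2 \<in> Dset R"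
    and C: "\<And>z. z \<in> Dset R \<Longrightarrow>
      onorm (dyfy F z) * norm (py z1 - py z2) + onorm (dlxfy F z) * norm (plx z1 - plx z2) \<le> C"
  shows "norm (py (F z1) - py (F z2)) \<le> C"
proof -
  define d where "d = z1 - z2"
  define p where "p t = z2 + t *\<^sub>R d" for t :: real
  have pD: "p t \<in> Dset R" if "t \<in> {0..1}" for t
  proof -
    have "p t = (1 - t) *\<^sub>R z2 + t *\<^sub>R z1" by (simp add: p_def d_def algebra_simps)
    thus ?thesis using convexD_alt[OF convex_Dset z(2,1)] that by simp
  qed
  have d: "d = elx (plx d) + ey (py d)" by (metis mk_eq mk_simps(5))
  have "norm (py (F (p 1)) - py (F (p 0))) \<le> C * norm (1 - 0 :: real)"
  proof (rule differentiable_bound[of "{0..1}" "\<lambda>t. py (F (p t))" "\<lambda>t h. h *\<^sub>R py (DF F (p t) d)"])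
    fix t :: real assume t: "t \<in> {0..1}"
    have "((\<lambda>t. F (p t)) has_derivative (\<lambda>h. DF F (p t) (h *\<^sub>R d))) (at t within {0..1})"
      by (rule has_derivative_compose[where f=p and g=F, OF _ der[OF pD[OF t]]])
         (auto simp: p_def[abs_def] intro!: derivative_eq_intros)
    from bounded_linear.has_derivative[OF bounded_linear_proj(3) this]
    show "((\<lambda>t. py (F (p t))) has_derivative (\<lambda>h. h *\<^sub>R py (DF F (p t) d))) (at t within {0..1})"
      using linear_DF[OF pD[OF t]] by (simp add: linear_scale proj_diff)
    have "py (DF F (p t) d) = dlxfy F (p t) (plx d) + dyfy F (p t) (py d)"
      using linear_DF[OF pD[OF t]] by (subst d) (simp add: linear_add dlxfy_def dyfy_def proj_diff)
    hence "norm (py (DF F (p t) d)) \<le> onorm (dlxfy F (p t)) * norm (plx d) + onorm (dyfy F (p t)) * norm (py d)"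
      using norm_triangle_mono[OF onorm[OF bounded_linear_blocks(2)[OF pD[OF t]], of "plx d"]
          onorm[OF bounded_linear_blocks(1)[OF pD[OF t]], of "py d"]] by simp
    also have "\<dots> \<le> C" using C[OF pD[OF t]] by (simp add: d_def proj_diff)
    finally have "norm (py (DF F (p t) d)) \<le> C" .
    thus "onorm (\<lambda>h. h *\<^sub>R py (DF F (p t) d)) \<le> C"
      using mult_right_mono[of "norm (py (DF F (p t) d))" C "\<bar>h\<bar>" for h]
      by (intro onorm_le) (simp only: norm_scaleR real_norm_def abs_ge_zero mult.commute[of "\<bar>_\<bar>" "norm (py _)"])
  qed auto
  thus ?thesis by (simp add: p_def d_def)
qed

text \<open>Each entry may come from a different point of P(z); this freedom is what a row-by-row
  mean value theorem needs. Boundedness of the derivative makes the \<open>INF\<close> and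
  \<open>SUP\<close> genuine bounds.\<close>

lemma ivl_mat_dlxflx:
  assumes "linear A"
    and "\<And>i j. i \<in> Basis \<Longrightarrow> j \<in> Basis \<Longrightarrow> \<exists>w\<in>Pset R z. A j \<bullet> i = dlxflx F w j \<bullet> i"
  shows "A \<in> ivl_mat (dlxflx F) (Pset R z)"
proof -
  obtain B where B: "0 \<le> B" "\<And>z v. z \<in> Dset R \<Longrightarrow> norm (dlxflx F z v) \<le> B * norm v"
    using blocks_bounded by metis
  have bd: "\<bar>dlxflx F w j \<bullet> i\<bar> \<le> B" if "i \<in> Basis" "j \<in> Basis" "w \<in> Pset R z" for w i j
  proof -
    have "\<bar>dlxflx F w j \<bullet> i\<bar> \<le> norm (dlxflx F w j)" using that(1) by (rule Basis_le_norm)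
    also have "\<dots> \<le> B" using B(2)[of w j] that by (simp add: Pset_def)
    finally show ?thesis .
  qed
  have "(INF w\<in>Pset R z. dlxflx F w j \<bullet> i) \<le> A j \<bullet> i \<and> A j \<bullet> i \<le> (SUP w\<in>Pset R z. dlxflx F w j \<bullet> i)"
    if ij: "i \<in> Basis" "j \<in> Basis" for i j
  proof -
    obtain w where w: "w \<in> Pset R z" "A j \<bullet> i = dlxflx F w j \<bullet> i" using assms(2)[OF ij] by blast
    have "bdd_below ((\<lambda>w. dlxflx F w j \<bullet> i) ` Pset R z)"
      by (rule bdd_belowI[of _ "- B"]) (use bd[OF ij] in \<open>fastforce simp: abs_le_iff\<close>)
    moreover have "bdd_above ((\<lambda>w. dlxflx F w j \<bullet> i) ` Pset R z)"
      by (rule bdd_aboveI[of _ B]) (use bd[OF ij] in \<open>fastforce simp: abs_le_iff\<close>)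
    ultimately show ?thesis using w by (auto intro: cINF_lower cSUP_upper)
  qed
  thus ?thesis using assms(1) by (simp add: ivl_mat_def)
qed

text \<open>The move from \<open>z2\<close> to \<open>z1\<close> is split at a corner. The
  horizontal leg expands by the interval matrix bound, the vertical one costs at most K times the
  norm of the y-derivative, and the difference of the two factors is
  \<open>xi_cu1P F R K\<close>.\<close>

lemma flx_lower:
  assumes z: "z1 \<in> Dset R" "z2 \<in> Dset R" and K: "0 \<le> K"
    and near: "norm (pl z1 - pl z2) \<le> RLam / 2"
    and cone: "norm (py z1 - py z2) \<le> K * norm (plx z1 - plx z2)"
  shows "xi_cu1P F R K * norm (plx z1 - plx z2) \<le> norm (plx (F z1) - plx (F z2))"
proof -
  define d where "d = plx z1 - plx z2"
  \<comment> \<open>The corner has the base point of \<open>z2\<close> and the fibre coordinate of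
    \<open>z1\<close>, so each leg moves one group of variables only.\<close>
  define zm where "zm = mk (plx z2) (py z1)"
  have zm: "zm \<in> Dset R" using z by (simp add: zm_def Dset_def)
  define p where "p t = mk (plx z2 + t *\<^sub>R d) (py z1)" for t
  have pP: "p t \<in> Pset R zm" if t: "t \<in> {0..1}" for t
  proof -
    have "norm ((1 - t) *\<^sub>R px z2 + t *\<^sub>R px z1) \<le> R"
      using convexD_alt[of "cball 0 R" "px z2" "px z1" t] t z by (auto simp: Dset_def)
    hence "p t \<in> Dset R" using z
      by (simp add: p_def d_def Dset_def algebra_simps)
    moreover have "t * norm (pl z1 - pl z2) \<le> 1 * norm (pl z1 - pl z2)"
      using t by (intro mult_right_mono) auto
    hence "norm (pl (p t) - pl zm) \<le> RLam / 2"
      using near t by (simp add: p_def zm_def d_def)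
    ultimately show ?thesis by (simp add: Pset_def)
  qed
  have pD: "p t \<in> Dset R" if t: "t \<in> {0..1}" for t using pP[OF t] by (simp add: Pset_def)
  have p01: "p 0 = zm" "p 1 = z1" by (simp_all add: p_def zm_def d_def)
  have "\<exists>t\<in>{0..1}. (plx (F z1) - plx (F zm)) \<bullet> i = dlxflx F (p t) d \<bullet> i" for i
  proof -
    have "\<exists>t\<in>{0..1}. plx (F (p 1)) \<bullet> i - plx (F (p 0)) \<bullet> i = (1 - 0) * (dlxflx F (p t) d \<bullet> i)"
    proof (rule mvt_very_simple[of 0 1 "\<lambda>t. plx (F (p t)) \<bullet> i"])
      fix t :: real assume t: "0 \<le> t" "t \<le> 1"
      hence pt: "p t \<in> Dset R" using pD by simp
      have pe: "p t = elx (plx z2 + t *\<^sub>R d) + ey (py z1)" for t by (simp add: p_def mk_eq)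
      have "(p has_derivative (\<lambda>h. elx (h *\<^sub>R d))) (at t within {0..1})"
        unfolding pe by (auto intro!: derivative_eq_intros bounded_linear.has_derivative[OF bounded_linear_proj(5)])
      hence "((\<lambda>t. F (p t)) has_derivative (\<lambda>h. DF F (p t) (elx (h *\<^sub>R d)))) (at t within {0..1})"
        by (rule has_derivative_compose[where f=p and g=F, OF _ der[OF pt]])
      from bounded_linear.has_derivative[OF bounded_linear_proj(4) this]
      have "((\<lambda>t. plx (F (p t))) has_derivative (\<lambda>h. dlxflx F (p t) (h *\<^sub>R d))) (at t within {0..1})"
        by (simp add: dlxflx_def comp_def)
      hence "((\<lambda>t. plx (F (p t)) \<bullet> i) has_derivative (\<lambda>h. dlxflx F (p t) (h *\<^sub>R d) \<bullet> i)) (at t within {0..1})"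
        by (rule has_derivative_inner_left)
      moreover have "dlxflx F (p t) (h *\<^sub>R d) = h *\<^sub>R dlxflx F (p t) d" for h
        using bounded_linear_blocks(4)[OF pt] by (simp add: linear_scale bounded_linear.linear)
      ultimately show "((\<lambda>t. plx (F (p t)) \<bullet> i) has_derivative (\<lambda>h. h * (dlxflx F (p t) d \<bullet> i))) (at t within {0..1})"
        by simp
    qed simp
    thus ?thesis by (simp add: p01 inner_diff_left)
  qed
  then obtain t where t: "\<And>i. t i \<in> {0..1}"
    "\<And>i. (plx (F z1) - plx (F zm)) \<bullet> i = dlxflx F (p (t i)) d \<bullet> i" by metis
  \<comment> \<open>A vector-valued function has no single mean value point. Row \<open>i\<close> of
    \<open>A\<close> is taken from the derivative at its own point \<open>p (t i)\<close>, so that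
    \<open>A d\<close> equals the increment exactly.\<close>
  define A where "A v = (\<Sum>i\<in>Basis. (dlxflx F (p (t i)) v \<bullet> i) *\<^sub>R i)" for v
  have lin: "linear (dlxflx F (p (t i)))" for i
    using bounded_linear_blocks(4)[OF pD[OF t(1)]] by (rule bounded_linear.linear)
  have Ai: "A v \<bullet> i = dlxflx F (p (t i)) v \<bullet> i" if "i \<in> Basis" for v i
    using that by (simp add: A_def)
  have "linear A" unfolding A_def
    by (intro linearI)
       (simp_all add: linear_add[OF lin] linear_scale[OF lin] inner_add_left scaleR_add_left sum.distrib scaleR_sum_right)
  hence A: "A \<in> ivl_mat (dlxflx F) (Pset R zm)"
    by (rule ivl_mat_dlxflx) (use Ai pP[OF t(1)] in blast)
  have Ad: "A d = plx (F z1) - plx (F zm)"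
    by (rule euclidean_eqI) (simp add: Ai t(2))
  let ?I = "INF z\<in>(Dset R :: ('c,'u,'s) st set). mset (ivl_mat (dlxflx F) (Pset R z))"
  let ?S = "SUP z\<in>(Dset R :: ('c,'u,'s) st set). onorm (dyflx F z)"
  have "?I \<le> mset (ivl_mat (dlxflx F) (Pset R zm))"
  proof (rule cINF_lower[OF _ zm])
    \<comment> \<open>0 is a lower bound because no interval matrix here is empty: the one for z
      contains \<open>dlxflx F z\<close>, as z lies in P(z).\<close>
    show "bdd_below ((\<lambda>z. mset (ivl_mat (dlxflx F) (Pset R z))) ` Dset R)"
    proof (rule bdd_belowI2)
      fix z :: "('c,'u,'s) st" assume z: "z \<in> Dset R"
      have "dlxflx F z \<in> ivl_mat (dlxflx F) (Pset R z)"
      proof (rule ivl_mat_dlxflx)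
        show "linear (dlxflx F z)" using bounded_linear_blocks(4)[OF z] by (rule bounded_linear.linear)
        have "z \<in> Pset R z" using z by (simp add: Pset_def RLam_def)
        thus "\<exists>w\<in>Pset R z. dlxflx F z j \<bullet> i = dlxflx F w j \<bullet> i" for i j by blast
      qed
      thus "0 \<le> mset (ivl_mat (dlxflx F) (Pset R z))" by (rule mset_lower)
    qed
  qed
  hence "?I * norm d \<le> mset (ivl_mat (dlxflx F) (Pset R zm)) * norm d" by (simp add: mult_right_mono)
  also have "\<dots> \<le> norm (plx (F z1) - plx (F zm))" using mset_lower(2)[OF A, of d] by (simp add: Ad)
  finally have 1: "?I * norm d \<le> norm (plx (F z1) - plx (F zm))" .
  obtain B where B: "\<And>z. z \<in> Dset R \<Longrightarrow> onorm (dyflx F z) \<le> B"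
    using onorm_blocks_bounded by metis
  have S: "onorm (dyflx F z) \<le> ?S" if "z \<in> Dset R" for z
    by (rule cSUP_upper[OF that bdd_aboveI2[OF B]])
  have S0: "0 \<le> ?S" using S[OF zero_in_Dset] onorm_pos_le[OF bounded_linear_blocks(3)[OF zero_in_Dset]] by linarith
  have "norm (plx (F (mk (plx z2) (py z1))) - plx (F (mk (plx z2) (py z2)))) \<le> ?S * norm (py z1 - py z2)"
  proof (rule differentiable_bound[of "cball 0 R" "\<lambda>y. plx (F (mk (plx z2) y))" "\<lambda>y. dyflx F (mk (plx z2) y)"])
    fix y :: "real^'s" assume "y \<in> cball 0 R"
    hence yD: "mk (plx z2) y \<in> Dset R" using z by (simp add: Dset_def)
    show "onorm (dyflx F (mk (plx z2) y)) \<le> ?S" by (rule S[OF yD])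
    have "((\<lambda>y. mk (plx z2) y) has_derivative ey) (at y within cball 0 R)"
      unfolding mk_eq by (auto intro!: derivative_eq_intros bounded_linear_imp_has_derivative bounded_linear_proj)
    hence "((\<lambda>y. F (mk (plx z2) y)) has_derivative (\<lambda>v. DF F (mk (plx z2) y) (ey v))) (at y within cball 0 R)"
      by (rule has_derivative_compose[where f="mk (plx z2)" and g=F, OF _ der[OF yD]])
    from bounded_linear.has_derivative[OF bounded_linear_proj(4) this]
    show "((\<lambda>y. plx (F (mk (plx z2) y))) has_derivative dyflx F (mk (plx z2) y)) (at y within cball 0 R)"
      by (simp add: dyflx_def comp_def)
  qed (use z in \<open>auto simp: Dset_def\<close>)
  also have "\<dots> \<le> ?S * (K * norm d)" using cone S0 by (simp add: d_def mult_left_mono)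
  finally have 2: "norm (plx (F zm) - plx (F z2)) \<le> K * ?S * norm d" by (simp add: zm_def algebra_simps)
  have "norm (plx (F z1) - plx (F zm)) \<le> norm (plx (F z1) - plx (F z2)) + norm (plx (F zm) - plx (F z2))"
    using norm_triangle_ineq4[of "plx (F z1) - plx (F z2)" "plx (F zm) - plx (F z2)"] by simp
  moreover have "xi_cu1P F R K * norm d = ?I * norm d - K * ?S * norm d"
    unfolding xi_cu1P_def by (simp add: left_diff_distrib)
  ultimately show ?thesis using 1 2 unfolding d_def[symmetric] by linarith
qed

end

section \<open>Cone conditions and the graph transform\<close>

lemma in_Js_same_y:
  assumes "in_Js z M w" "py w = py z"
  shows "eqv w z"
proof -
  obtain n where n: "n \<in> Zlat" "norm ((pl w + n - pl z, px w - px z)) \<le> M * norm (py w - py z)"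
    using assms(1) by (auto simp: in_Js_def)
  hence "(pl w + n - pl z, px w - px z) = 0" using assms(2) by simp
  hence "pl w - pl z = - n" "px w = px z" by (auto simp: zero_prod_def algebra_simps)
  thus ?thesis using n(1) assms(2) by (auto simp: eqv_def Zlat_uminus)
qed

lemma RLam_pos: "0 < RLam" by (simp add: RLam_def)

locale cu_system = torus_lift F R
  for F :: "('c::finite,'u::finite,'s::finite) st \<Rightarrow> ('c,'u,'s) st" and R :: real +
  fixes L :: real
  assumes L_pos: "0 < L" and L_less_1: "L < 1"
    and cover: "covering_conditions F R L"
    and cone: "backward_cone_conditions F R L"
    and mu_less_1: "mu_s1 F R L < 1"
    and xi_pos: "0 < xi_cu1P F R L"
begin

lemma Uset_self: "z \<in> Dset R \<Longrightarrow> z \<in> Uset R L z"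
  by (simp add: Uset_def RLam_def zero_prod_def[symmetric])

text \<open>The covering condition of \<open>z\<close>, read at homotopy time 0 and at the point
  \<open>z\<close> itself, which lies in its own cone: the image cannot lie on the face norm y =
  R.\<close>

lemma no_exit_y:
  assumes "z \<in> Dset R" "F z \<in> Dset R"
  shows "norm (py (F z)) < R"
proof (rule ccontr)
  assume "\<not> ?thesis"
  hence eq: "norm (py (F z)) = R" using assms(2) by (simp add: Dset_def)
  obtain lam and h :: "real \<times> ('c,'u,'s) st \<Rightarrow> ('c,'u,'s) st" where
    h: "h ` ({0..1} \<times> Uset R L z) \<subseteq> ball lam RLam \<times> UNIV \<times> UNIV"
       "\<forall>w\<in>Uset R L z. eqv (h (0, w)) (F w)"
       "\<forall>\<alpha>\<in>{0..1}. (\<lambda>w. h (\<alpha>, w)) ` (Uset R L z) \<inter> Dplus R lam = {}"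
    using cover assms(1) unfolding covering_conditions_def by meson
  note U = Uset_self[OF assms(1)]
  have "h (0, z) \<in> ball lam RLam \<times> UNIV \<times> UNIV" using h(1) U by force
  moreover have "px (h (0, z)) = px (F z)" "py (h (0, z)) = py (F z)"
    using h(2) U by (auto simp: eqv_def)
  ultimately have "h (0, z) \<in> Dplus R lam"
    using eq assms(2) by (auto simp: Dplus_def Dset_def px_def py_def mem_Times_iff)
  thus False using h(3) U by force
qed

text \<open>Again time 0 at \<open>z\<close> itself: a point of the exit face is mapped out of D.
  The exit face is open in y, whence the strict bound on \<open>py z\<close>.\<close>

lemma no_entry_side:
  assumes "z \<in> Dset R" "norm (py z) < R" "F z \<in> Dset R"
  shows "norm (px z) < R"
proof (rule ccontr)
  assume "\<not> ?thesis"
  hence eq: "norm (px z) = R" using assms(1) by (simp add: Dset_def)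
  obtain lam and h :: "real \<times> ('c,'u,'s) st \<Rightarrow> ('c,'u,'s) st" where
    h: "h ` ({0..1} \<times> Uset R L z) \<subseteq> ball lam RLam \<times> UNIV \<times> UNIV"
       "\<forall>w\<in>Uset R L z. eqv (h (0, w)) (F w)"
       "\<forall>\<alpha>\<in>{0..1}. (\<lambda>w. h (\<alpha>, w)) ` (Uset R L z \<inter> Dminus R (pl z)) \<inter> Dloc R lam = {}"
    using cover assms(1) unfolding covering_conditions_def by meson
  note U = Uset_self[OF assms(1)]
  have "z \<in> Dminus R (pl z)"
    using eq assms(2) by (auto simp: Dminus_def pl_def px_def py_def mem_Times_iff RLam_def)
  moreover have "h (0, z) \<in> ball lam RLam \<times> UNIV \<times> UNIV" using h(1) U by force
  moreover have "px (h (0, z)) = px (F z)" "py (h (0, z)) = py (F z)"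
    using h(2) U by (auto simp: eqv_def)
  ultimately have "h (0, z) \<in> Dloc R lam"
    using assms(3) by (auto simp: Dloc_def Dset_def px_def py_def mem_Times_iff)
  thus False using h(3) U \<open>z \<in> Dminus R (pl z)\<close> by force
qed

text \<open>The disc over a fixed lambda lies in the unstable cone of its centre, because lambda
  does not vary and y varies with slope at most 1/L. The covering homotopy restricted to it
  satisfies the hypotheses of \<open>covering_disc\<close>.\<close>

lemma disc_meets_Dset:
  fixes y :: "real^'u \<Rightarrow> real^'s"
  assumes cy: "continuous_on (cball 0 R) y"
    and yR: "\<And>x. norm x \<le> R \<Longrightarrow> norm (y x) < R"
    and yL: "\<And>x. norm x \<le> R \<Longrightarrow> norm (y x - y 0) \<le> 1/L * norm x"
  obtains x where "norm x \<le> R" "F (mk (l, x) (y x)) \<in> Dset R"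
proof -
  define z :: "('c,'u,'s) st" where "z = mk (l, 0) (y 0)"
  have zD: "z \<in> Dset R" using yR[of 0] R_pos by (simp add: z_def)
  obtain lam and h :: "real \<times> ('c,'u,'s) st \<Rightarrow> ('c,'u,'s) st" and A :: "real^'u \<Rightarrow> real^'u" where
    h: "continuous_on ({0..1} \<times> Uset R L z) h"
       "h ` ({0..1} \<times> Uset R L z) \<subseteq> ball lam RLam \<times> UNIV \<times> UNIV"
       "\<forall>w\<in>Uset R L z. eqv (h (0, w)) (F w)"
       "\<forall>\<alpha>\<in>{0..1}. (\<lambda>w. h (\<alpha>, w)) ` (Uset R L z \<inter> Dminus R (pl z)) \<inter> Dloc R lam = {} \<and>
            (\<lambda>w. h (\<alpha>, w)) ` (Uset R L z) \<inter> Dplus R lam = {}"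
       "\<forall>w\<in>Uset R L z. h (1, w) = (lam, A (px w), 0)"
       "linear A" "A ` sphere 0 R \<subseteq> - cball 0 R"
    using bspec[OF cover[unfolded covering_conditions_def] zD] by (elim exE conjE) (rule that)
  define \<beta> :: "real^'u \<Rightarrow> ('c,'u,'s) st" where "\<beta> x = mk (l, x) (y x)" for x
  have \<beta>U: "\<beta> x \<in> Uset R L z" if "norm x \<le> R" for x
    using that yR[OF that] yL[OF that] by (simp add: Uset_def \<beta>_def z_def RLam_def norm_Pair)
  have \<beta>m: "\<beta> x \<in> Dminus R (pl z)" if "norm x = R" for x
    using that yR[of x] by (simp add: Dminus_def \<beta>_def z_def mk_def pl_def RLam_def)
  have "continuous_on (cball 0 R) \<beta>" unfolding \<beta>_def by (intro continuous_intros cy)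
  hence "continuous_on ({0..1} \<times> cball 0 R) (\<lambda>p. \<beta> (snd p))"
    by (rule continuous_on_compose2[OF _ continuous_on_snd[OF continuous_on_id]]) auto
  hence ch: "continuous_on ({0..1} \<times> cball 0 R) (\<lambda>p. h (fst p, \<beta> (snd p)))"
    by (intro continuous_on_compose2[OF h(1)] continuous_intros) (auto intro: \<beta>U)
  \<comment> \<open>The homotopy stays in one chart, so a point outside \<open>Dloc\<close> or
    \<open>Dplus\<close> can only be excluded by its x and y components.\<close>
  have hb: "fst (h (t, \<beta> x)) \<in> cball lam RLam" if "t \<in> {0..1}" "norm x \<le> R" for t x
  proof -
    have "h (t, \<beta> x) \<in> ball lam RLam \<times> UNIV \<times> UNIV" using h(2) \<beta>U[OF that(2)] that(1) by force
    thus ?thesis by (auto simp: mem_Times_iff)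
  qed
  define X where "X p = px (h (fst p, \<beta> (snd p)))" for p
  define Y where "Y p = py (h (fst p, \<beta> (snd p)))" for p
  have "\<exists>x. norm x \<le> R \<and> norm (X (0, x)) \<le> R \<and> norm (Y (0, x)) \<le> R"
  proof (rule covering_disc[of R X Y A])
    show "continuous_on ({0..1} \<times> cball 0 R) X" "continuous_on ({0..1} \<times> cball 0 R) Y"
      unfolding X_def Y_def by (intro continuous_intros ch)+
    show "R < norm (Y (t, x))" if t: "t \<in> {0..1}" and x: "norm x = R" and X: "norm (X (t, x)) \<le> R" for t x
    proof -
      have "h (t, \<beta> x) \<notin> Dloc R lam" using h(4) t \<beta>U[of x] \<beta>m[OF x] x by blast
      thus ?thesis using hb[OF t, of x] X x
        by (auto simp: Dloc_def X_def Y_def mem_Times_iff px_def py_def)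
    qed
    show "norm (Y (t, x)) \<noteq> R" if t: "t \<in> {0..1}" and x: "norm x \<le> R" and X: "norm (X (t, x)) \<le> R" for t x
    proof -
      have "h (t, \<beta> x) \<notin> Dplus R lam" using h(4) t \<beta>U[OF x] by blast
      thus ?thesis using hb[OF t x] X
        by (auto simp: Dplus_def X_def Y_def mem_Times_iff px_def py_def)
    qed
    show "X (1, x) = A x" "Y (1, x) = 0" if "norm x \<le> R" for x
      using h(5) \<beta>U[OF that] by (auto simp: X_def Y_def px_def py_def \<beta>_def mk_def)
    show "R < norm (A x)" if "norm x = R" for x using h(7) that by force
  qed (use R_pos h(6) in auto)
  then obtain x where x: "norm x \<le> R" "norm (X (0, x)) \<le> R" "norm (Y (0, x)) \<le> R" by blast
  have "eqv (h (0, \<beta> x)) (F (\<beta> x))" using h(3) \<beta>U[OF x(1)] by blast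
  hence "F (\<beta> x) \<in> Dset R" using x(2,3) by (auto simp: eqv_def Dset_def X_def Y_def)
  thus ?thesis using that x(1) by (simp add: \<beta>_def)
qed

section \<open>Graphs over the base strip that meet stable cones only in their vertices\<close>

definition Q :: "((real^'c) \<times> (real^'u)) set" where "Q = UNIV \<times> cball 0 R"

lemma mem_Q: "q \<in> Q \<longleftrightarrow> norm (snd q) \<le> R"
  by (auto simp: Q_def mem_Times_iff)

lemma convex_Q: "convex Q" by (simp add: Q_def convex_Times)

lemma Q_translate [simp]: "q + (n, 0) \<in> Q \<longleftrightarrow> q \<in> Q" by (simp add: mem_Q)

text \<open>The slope bound is phrased by stable cones because backward cone conditions pull back
  precisely this. Since \<open>in_Js\<close> chooses the lattice vector, the condition contains
  periodicity of \<open>b\<close> as well as the Lipschitz bound L within a chart.\<close>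

definition cu_graph :: "((real^'c) \<times> (real^'u) \<Rightarrow> real^'s) \<Rightarrow> bool" where
  "cu_graph b \<longleftrightarrow> (\<forall>q\<in>Q. norm (b q) < R) \<and>
     (\<forall>q\<in>Q. \<forall>q'\<in>Q. in_Js (mk q (b q)) (1/L) (mk q' (b q')) \<longrightarrow> b q' = b q)"

lemma cu_graph_Dset: "cu_graph b \<Longrightarrow> q \<in> Q \<Longrightarrow> mk q (b q) \<in> Dset R"
  by (auto simp: cu_graph_def mem_Q intro: less_imp_le)

lemma in_Js_mkI:
  assumes "norm (fst q' - fst q) \<le> RLam" "norm (q' - q) \<le> M * norm (y' - y)"
  shows "in_Js (mk q y) M (mk q' y')"
proof -
  have "(fst q' - fst q, snd q' - snd q) = q' - q" by (simp add: prod_eq_iff)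
  thus ?thesis using assms unfolding in_Js_def by (intro bexI[of _ 0]) auto
qed

text \<open>After translation by -n the horizontal displacement is zero, and such a point lies in
  every stable cone.\<close>

lemma cu_graph_periodic:
  assumes "cu_graph b" "q \<in> Q" "n \<in> Zlat"
  shows "b (q + (n, 0)) = b q"
proof -
  have "in_Js (mk q (b q)) (1/L) (mk (q + (n, 0)) (b (q + (n, 0))))"
    using assms(3) L_pos RLam_pos unfolding in_Js_def
    by (intro bexI[of _ "- n"]) (auto simp: Zlat_uminus zero_prod_def[symmetric])
  thus ?thesis using assms by (simp add: cu_graph_def)
qed

text \<open>A pair violating the bound would lie in a common stable cone, hence have equal values
  and not violate it.\<close>

lemma cu_graph_lipschitz:
  assumes b: "cu_graph b" and q: "q \<in> Q" "q' \<in> Q" and near: "norm (fst q - fst q') \<le> RLam"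
  shows "norm (b q - b q') \<le> L * norm (q - q')"
proof (rule ccontr)
  assume *: "\<not> ?thesis"
  hence "norm (q - q') \<le> 1/L * norm (b q - b q')" using L_pos by (simp add: field_simps)
  hence "in_Js (mk q' (b q')) (1/L) (mk q (b q))" using near by (intro in_Js_mkI)
  hence "b q = b q'" using b q by (simp add: cu_graph_def)
  thus False using * L_pos by simp
qed

lemma lipschitz_near_continuous:
  assumes "\<And>q q'. q \<in> Q \<Longrightarrow> q' \<in> Q \<Longrightarrow> norm (fst q - fst q') \<le> RLam / 2 \<Longrightarrow> norm (b q - b q') \<le> K * norm (q - q')"
    and "0 \<le> K"
  shows "continuous_on Q b"
  unfolding continuous_on_iff
proof (intro ballI allI impI)
  fix q e assume q: "q \<in> Q" and e: "0 < (e::real)"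
  define d where "d = min (RLam / 2) (e / (K + 1))"
  have d: "0 < d" using e assms(2) RLam_pos by (simp add: d_def)
  have "dist (b q') (b q) < e" if q': "q' \<in> Q" "dist q' q < d" for q'
  proof -
    have n: "norm (q' - q) < RLam / 2" "norm (q' - q) < e / (K + 1)"
      using q'(2) by (auto simp: d_def dist_norm)
    have "norm (fst q' - fst q) \<le> norm (q' - q)" by (metis fst_diff norm_fst_le prod.collapse)
    hence "norm (b q' - b q) \<le> K * norm (q' - q)" using assms(1)[OF q'(1) q] n by simp
    also have "\<dots> \<le> K * (e / (K + 1))" using n assms(2) by (intro mult_left_mono) auto
    also have "\<dots> < e" using e assms(2) by (simp add: field_simps)
    finally show ?thesis by (simp add: dist_norm)
  qed
  thus "\<exists>d>0. \<forall>q'\<in>Q. dist q' q < d \<longrightarrow> dist (b q') (b q) < e" using d by blast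
qed

lemma cu_graph_continuous: "cu_graph b \<Longrightarrow> continuous_on Q b"
  by (rule lipschitz_near_continuous[of b L]) (use cu_graph_lipschitz L_pos RLam_pos in auto)

lemma continuous_graph_map:
  assumes "cu_graph b" "S \<subseteq> Q"
  shows "continuous_on S (\<lambda>q. F (mk q (b q)))"
proof (rule continuous_on_subset[OF _ assms(2)])
  show "continuous_on Q (\<lambda>q. F (mk q (b q)))"
    by (rule continuous_on_compose2[OF cont_F])
       (use cu_graph_Dset[OF assms(1)] in \<open>auto intro!: continuous_intros cu_graph_continuous[OF assms(1)]\<close>)
qed

text \<open>The lower bound makes the base component of F along the graph injective near
  \<open>p\<close>, and invariance of domain applies because \<open>no_entry_side\<close> puts
  \<open>p\<close> in the interior of the strip. The slope K is kept apart from L so that better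
  slopes can be inserted later.\<close>

lemma graph_map_open:
  assumes b: "cu_graph b"
    and lip: "\<And>q q'. q \<in> Q \<Longrightarrow> q' \<in> Q \<Longrightarrow> norm (fst q - fst q') \<le> RLam / 2 \<Longrightarrow> norm (b q - b q') \<le> K * norm (q - q')"
    and K: "0 \<le> K" "0 < xi_cu1P F R K"
    and p: "p \<in> Q" and FpD: "F (mk p (b p)) \<in> Dset R"
  obtains W where "p \<in> W" "W \<subseteq> Q" "open ((\<lambda>q. plx (F (mk q (b q)))) ` W)"
    "\<And>q. q \<in> W \<Longrightarrow> norm (py (F (mk q (b q)))) < R"
    "\<And>q q'. q \<in> W \<Longrightarrow> q' \<in> W \<Longrightarrow> norm (fst q - fst q') \<le> RLam / 2 \<and>
       xi_cu1P F R K * norm (q - q') \<le> norm (plx (F (mk q (b q))) - plx (F (mk q' (b q'))))"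
proof -
  let ?I = "UNIV \<times> ball 0 R :: ((real^'c) \<times> (real^'u)) set"
  \<comment> \<open>Radius RLam/4 keeps any two points of \<open>W\<close> within the distance
    RLam/2 required by \<open>flx_lower\<close>.\<close>
  define W where "W = (?I \<inter> (\<lambda>q. norm (py (F (mk q (b q))))) -` {..<R}) \<inter> ball p (RLam / 4)"
  have IQ: "?I \<subseteq> Q" by (auto simp: Q_def)
  have WQ: "W \<subseteq> Q" using IQ by (auto simp: W_def)
  have "continuous_on ?I (\<lambda>q. norm (py (F (mk q (b q)))))"
    by (intro continuous_intros continuous_graph_map[OF b IQ])
  hence oW: "open W" unfolding W_def
    by (intro open_Int continuous_open_preimage open_Times) auto
  have pD: "mk p (b p) \<in> Dset R" and bp: "norm (b p) < R"
    using b p cu_graph_Dset[OF b p] by (auto simp: cu_graph_def)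
  have pW: "p \<in> W"
    using no_entry_side[OF pD _ FpD] no_exit_y[OF pD FpD] bp RLam_pos
    by (simp add: W_def mem_Times_iff)
  have est: "norm (fst q - fst q') \<le> RLam / 2 \<and>
       xi_cu1P F R K * norm (q - q') \<le> norm (plx (F (mk q (b q))) - plx (F (mk q' (b q'))))"
    if qq: "q \<in> W" "q' \<in> W" for q q'
  proof -
    have "norm (fst q - fst q') \<le> norm (q - q')" by (metis fst_diff norm_fst_le prod.collapse)
    also have "norm (q - q') \<le> norm (q - p) + norm (q' - p)" using norm_triangle_ineq4[of "q - p" "q' - p"] by simp
    also have "\<dots> \<le> RLam / 2" using qq by (auto simp: W_def dist_norm norm_minus_commute)
    finally have n: "norm (fst q - fst q') \<le> RLam / 2" .
    moreover have "xi_cu1P F R K * norm (plx (mk q (b q)) - plx (mk q' (b q')))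
        \<le> norm (plx (F (mk q (b q))) - plx (F (mk q' (b q'))))"
      using qq WQ lip[of q q'] n K by (intro flx_lower cu_graph_Dset[OF b]) auto
    ultimately show ?thesis by simp
  qed
  have "inj_on (\<lambda>q. plx (F (mk q (b q)))) W"
  proof (rule inj_onI)
    fix q q' assume "q \<in> W" "q' \<in> W" "plx (F (mk q (b q))) = plx (F (mk q' (b q')))"
    hence "xi_cu1P F R K * norm (q - q') \<le> 0" using est[of q q'] by simp
    thus "q = q'" using K(2) by (simp add: mult_le_0_iff)
  qed
  hence "open ((\<lambda>q. plx (F (mk q (b q)))) ` W)"
    by (intro invariance_of_domain continuous_intros continuous_graph_map[OF b WQ] oW)
  thus ?thesis by (rule that[OF pW WQ _ _ est]) (auto simp: W_def)
qed

end

text \<open>On the segment from y to x the increments have collinear arguments, so the bounds of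
  adjacent subintervals add up without loss; bisection then reaches the whole segment.\<close>

lemma lipschitz_local_to_global:
  fixes f :: "'a::real_normed_vector \<Rightarrow> 'b::real_normed_vector"
  assumes S: "convex S"
    and loc: "\<And>x. x \<in> S \<Longrightarrow> \<exists>U. open U \<and> x \<in> U \<and> (\<forall>y\<in>U \<inter> S. \<forall>z\<in>U \<inter> S. norm (f y - f z) \<le> C * norm (y - z))"
    and xy: "x \<in> S" "y \<in> S"
  shows "norm (f x - f y) \<le> C * norm (x - y)"
proof -
  define p where "p t = y + t *\<^sub>R (x - y)" for t :: real
  have pS: "p t \<in> S" if "0 \<le> t" "t \<le> 1" for t
    using convexD_alt[OF S xy(2,1) that] by (simp add: p_def algebra_simps)
  have cp: "isCont p t" for t unfolding p_def by (intro continuous_intros)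
  let ?P = "\<lambda>a b. 0 \<le> a \<and> b \<le> 1 \<longrightarrow> norm (f (p b) - f (p a)) \<le> C * (b - a) * norm (x - y)"
  have "?P 0 1"
  proof (rule Bolzano[of 0 1 ?P])
    fix a b c :: real assume trans: "?P a b" "?P b c" "a \<le> b" "b \<le> c"
    show "?P a c"
    proof
      assume "0 \<le> a \<and> c \<le> 1"
      hence "norm (f (p b) - f (p a)) \<le> C * (b - a) * norm (x - y)"
        "norm (f (p c) - f (p b)) \<le> C * (c - b) * norm (x - y)" using trans by auto
      moreover have "norm (f (p c) - f (p a)) \<le> norm (f (p c) - f (p b)) + norm (f (p b) - f (p a))"
        by (metis norm_triangle_ineq diff_add_cancel add_diff_eq)
      ultimately have "norm (f (p c) - f (p a)) \<le> C * (c - b) * norm (x - y) + C * (b - a) * norm (x - y)"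
        by linarith
      thus "norm (f (p c) - f (p a)) \<le> C * (c - a) * norm (x - y)" by (simp add: algebra_simps)
    qed
  next
    fix t :: real assume local: "0 \<le> t" "t \<le> 1"
    obtain U where U: "open U" "p t \<in> U"
      "\<forall>y\<in>U \<inter> S. \<forall>z\<in>U \<inter> S. norm (f y - f z) \<le> C * norm (y - z)"
      using loc[OF pS[OF local]] by blast
    have "\<forall>\<^sub>F s in at t. p s \<in> U"
      using cp[of t] U(1,2) by (simp add: isCont_def topological_tendstoD)
    then obtain d where d: "0 < d" "\<And>s. s \<noteq> t \<Longrightarrow> dist s t < d \<Longrightarrow> p s \<in> U"
      by (auto simp: eventually_at)
    have pU: "p s \<in> U" if "\<bar>s - t\<bar> < d" for s
      using d(2)[of s] that U(2) by (cases "s = t") (auto simp: dist_real_def)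
    have "norm (f (p b) - f (p a)) \<le> C * (b - a) * norm (x - y)"
      if ab: "a \<le> t" "t \<le> b" "b - a < d" "0 \<le> a" "b \<le> 1" for a b
    proof -
      have "norm (f (p b) - f (p a)) \<le> C * norm (p b - p a)"
        using U(3) pU[of a] pU[of b] pS[of a] pS[of b] ab by auto
      also have "p b - p a = (b - a) *\<^sub>R (x - y)" by (simp add: p_def algebra_simps)
      finally show ?thesis using ab by simp
    qed
    thus "\<exists>d>0. \<forall>a b. a \<le> t \<and> t \<le> b \<and> b - a < d \<longrightarrow> ?P a b" using d(1) by blast
  qed simp
  thus ?thesis by (simp add: p_def)
qed

context cu_system begin

lemma cu_graph_transform:
  assumes b: "cu_graph b"
  obtains b' where "cu_graph b'" "\<And>q. q \<in> Q \<Longrightarrow> \<exists>p\<in>Q. eqv (F (mk p (b p))) (mk q (b' q))"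
proof -
  let ?G = "\<lambda>p. F (mk p (b p))"
  define S where "S = {q\<in>Q. \<exists>p\<in>Q. \<exists>y. norm y \<le> R \<and> eqv (?G p) (mk q y)}"
  have "openin (top_of_set Q) S"
  proof (subst openin_subopen, intro ballI)
    fix q assume "q \<in> S"
    then obtain p y where py: "q \<in> Q" "p \<in> Q" "norm y \<le> R" "eqv (?G p) (mk q y)"
      by (auto simp: S_def)
    have FpD: "?G p \<in> Dset R" using eqv_Dset[OF py(4)] py(1,3) by (simp add: mem_Q)
    obtain W where W: "p \<in> W" "W \<subseteq> Q" "open ((\<lambda>q. plx (?G q)) ` W)"
      "\<And>q. q \<in> W \<Longrightarrow> norm (py (?G q)) < R"
      by (rule graph_map_open[OF b _ _ xi_pos py(2) FpD])
         (use cu_graph_lipschitz[OF b] RLam_pos L_pos in auto)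
    obtain n where n: "n \<in> Zlat" "?G p = tr n (mk q y)" using py(4) by (auto simp: eqv_iff_tr)
    \<comment> \<open>A neighbourhood of q inside the image of the graph, after undoing the lattice
      vector by which the image of p differs from q.\<close>
    let ?O = "(\<lambda>v. v - (n, 0)) ` (\<lambda>q. plx (?G q)) ` W"
    have "open ?O" using W(3) by (rule open_translation_subtract)
    moreover have "q \<in> ?O"
    proof (rule image_eqI)
      show "q = plx (?G p) - (n, 0)" using n(2) by simp
      show "plx (?G p) \<in> (\<lambda>q. plx (?G q)) ` W" using W(1) by blast
    qed
    moreover have "Q \<inter> ?O \<subseteq> S"
    proof
      fix q' assume q': "q' \<in> Q \<inter> ?O"
      then obtain p' where p': "p' \<in> W" "q' = plx (?G p') - (n, 0)" by auto
      have "?G p' = tr n (mk q' (py (?G p')))" using p'(2) by (intro st_eqI) auto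
      hence "eqv (?G p') (mk q' (py (?G p')))" using eqv_tr[OF n(1)] by metis
      moreover have "norm (py (?G p')) \<le> R" using W(4)[OF p'(1)] by simp
      ultimately show "q' \<in> S" using W(2) p'(1) q' unfolding S_def by blast
    qed
    ultimately show "\<exists>T. openin (top_of_set Q) T \<and> q \<in> T \<and> T \<subseteq> S"
      using py(1) by (intro exI[of _ "Q \<inter> ?O"]) (auto simp: openin_open)
  qed
  moreover have "closedin (top_of_set Q) S"
  proof -
    \<comment> \<open>By periodicity of \<open>b\<close> the preimages may be taken with lambda in
      the unit cube. Their image is compact, and adding the closed lattice keeps it closed.\<close>
    let ?C = "cbox 0 1 \<times> cball 0 R :: ((real^'c) \<times> (real^'u)) set"
    have CQ: "?C \<subseteq> Q" by (auto simp: Q_def)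
    define C where "C = ?C \<inter> (\<lambda>p. norm (py (?G p))) -` {..R}"
    have C: "compact ?C" by (simp add: compact_Times)
    have cl: "closed ?C" by (intro closed_Times closed_cbox closed_cball)
    have "closed C" unfolding C_def
      by (rule continuous_closed_preimage[OF _ cl closed_atMost])
         (intro continuous_on_norm continuous_on_proj continuous_graph_map[OF b CQ])
    moreover have "C = ?C \<inter> C" by (auto simp: C_def)
    ultimately have cC: "compact C" using compact_Int_closed[OF C, of C] by argo
    have "C \<subseteq> Q" using CQ by (auto simp: C_def)
    hence "compact ((\<lambda>p. plx (?G p)) ` C)"
      by (intro compact_continuous_image continuous_on_proj continuous_graph_map[OF b] cC)
    moreover have "closed (Zlat \<times> {0} :: ((real^'c) \<times> (real^'u)) set)"
      by (intro closed_Times closed_Zlat closed_singleton)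
    ultimately have "closed (\<Union>x\<in>(\<lambda>p. plx (?G p)) ` C. \<Union>y\<in>Zlat \<times> {0}. {x + y})" (is "closed ?T")
      by (rule compact_closed_sums)
    moreover have "S = Q \<inter> ?T"
    proof (intro equalityI subsetI)
      fix q assume "q \<in> S"
      then obtain p y where py: "q \<in> Q" "p \<in> Q" "norm y \<le> R" "eqv (?G p) (mk q y)"
        by (auto simp: S_def)
      obtain m where m: "m \<in> Zlat" "fst p + m \<in> cbox 0 1" by (rule Zlat_unit_cube)
      define p' where "p' = p + (m, 0)"
      have "mk p' (b p') = tr m (mk p (b p))"
        using cu_graph_periodic[OF b py(2) m(1)] by (simp add: p'_def)
      hence "eqv (?G p') (mk q y)"
        using lift_tr[OF cu_graph_Dset[OF b py(2)] m(1)] py(4) eqv_trans by metis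
      then obtain n where n: "n \<in> Zlat" "?G p' = tr n (mk q y)" by (auto simp: eqv_iff_tr)
      have "p' \<in> C" using m(2) py(2,3) n(2) by (simp add: C_def p'_def mem_Times_iff mem_Q)
      moreover have "q = plx (?G p') + (- n, 0)" using n(2) by (simp add: zero_prod_def)
      ultimately show "q \<in> Q \<inter> ?T" using py(1) n(1) Zlat_uminus by blast
    next
      fix q assume q: "q \<in> Q \<inter> ?T"
      then obtain p n where p: "p \<in> C" "n \<in> Zlat" "q = plx (?G p) + (n, 0)" by auto
      have "?G p = tr (- n) (mk q (py (?G p)))" using p(3) by (intro st_eqI) (auto simp: zero_prod_def)
      hence "eqv (?G p) (mk q (py (?G p)))" using eqv_tr[OF Zlat_uminus[OF p(2)]] by metis
      moreover have "norm (py (?G p)) \<le> R" using p(1) by (simp add: C_def)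
      ultimately show "q \<in> S" using p(1) \<open>C \<subseteq> Q\<close> q unfolding S_def by blast
    qed
    ultimately show ?thesis by (auto simp: closedin_closed)
  qed
  moreover have "S \<noteq> {}"
  proof -
    have c0: "continuous_on (cball 0 R) (\<lambda>x. b (0, x))"
      by (rule continuous_on_compose2[OF cu_graph_continuous[OF b]]) (auto simp: mem_Q intro!: continuous_intros)
    have lip: "norm (b (0, x) - b (0, 0)) \<le> 1/L * norm x" if "norm x \<le> R" for x
    proof -
      have "norm (b (0, x) - b (0, 0)) \<le> L * norm ((0, x) - (0::real^'c, 0::real^'u))"
        using that RLam_pos R_pos by (intro cu_graph_lipschitz[OF b]) (auto simp: mem_Q)
      also have "\<dots> = L * norm x" by (simp add: norm_Pair)
      \<comment> \<open>Slope L is at most slope 1/L because L < 1; so the graph over the disc fits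
        into the unstable cone.\<close>
      also have "\<dots> \<le> 1/L * norm x"
        using L_pos L_less_1 mult_le_one[of L L] by (intro mult_right_mono) (auto simp: field_simps)
      finally show ?thesis .
    qed
    obtain x where x: "norm x \<le> R" "?G (0, x) \<in> Dset R"
      by (rule disc_meets_Dset[of "\<lambda>x. b (0, x)" 0]) (use c0 lip b in \<open>auto simp: cu_graph_def mem_Q\<close>)
    hence "plx (?G (0, x)) \<in> S" unfolding S_def
      by (auto simp: mem_Q Dset_def intro!: bexI[of _ "(0, x)"] exI[of _ "py (?G (0, x))"])
    thus ?thesis by blast
  qed
  moreover have "connected Q" using convex_Q by (rule convex_connected)
  ultimately have SQ: "S = Q" by (auto simp: connected_clopen)
  have "\<forall>q\<in>Q. \<exists>p y. p \<in> Q \<and> norm y \<le> R \<and> eqv (?G p) (mk q y)"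
    using SQ unfolding S_def by blast
  then obtain p b' where pb: "\<And>q. q \<in> Q \<Longrightarrow> p q \<in> Q" "\<And>q. q \<in> Q \<Longrightarrow> norm (b' q) \<le> R"
    "\<And>q. q \<in> Q \<Longrightarrow> eqv (?G (p q)) (mk q (b' q))"
    by metis
  have D: "?G (p q) \<in> Dset R" if "q \<in> Q" for q
    using eqv_Dset[OF pb(3)[OF that], of R] pb(2)[OF that] that by (simp add: mem_Q)
  have pD: "mk (p q) (b (p q)) \<in> Dset R" if "q \<in> Q" for q
    using cu_graph_Dset[OF b pb(1)[OF that]] .
  have "norm (b' q) < R" if "q \<in> Q" for q
    using no_exit_y[OF pD D, OF that that] pb(3)[OF that] by (simp add: eqv_def)
  \<comment> \<open>The cone relation is pulled back to the preimages, where the cone property of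
    \<open>b\<close> makes them the same torus point; their images then have equal y.\<close>
  moreover have "b' q' = b' q"
    if q: "q \<in> Q" "q' \<in> Q" and J: "in_Js (mk q (b' q)) (1/L) (mk q' (b' q'))" for q q'
  proof -
    have "in_Js (?G (p q)) (1/L) (?G (p q'))"
      using J by (rule in_Js_eqv[rotated 2]) (use pb(3) q eqv_sym in blast)+
    hence J': "in_Js (mk (p q) (b (p q))) (1/L) (mk (p q') (b (p q')))"
      using cone D pD q unfolding backward_cone_conditions_def by blast
    hence "b (p q') = b (p q)" using b pb(1) q by (simp add: cu_graph_def)
    hence "eqv (mk (p q') (b (p q'))) (mk (p q) (b (p q)))"
      using in_Js_same_y[OF J'] by simp
    hence "eqv (?G (p q')) (?G (p q))" using lift_eqv pD[OF q(1)] by blast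
    thus "b' q' = b' q" using pb(3)[OF q(1)] pb(3)[OF q(2)] by (simp add: eqv_def)
  qed
  ultimately have "cu_graph b'" by (simp add: cu_graph_def)
  thus ?thesis using that pb(1,3) by blast
qed

section \<open>Finite backward trajectories and their limits\<close>

primrec back_set :: "nat \<Rightarrow> ('c,'u,'s) st set" where
  "back_set 0 = Dset R"
| "back_set (Suc n) = {z \<in> Dset R. \<exists>w\<in>back_set n. eqv (F w) z}"

lemma back_set_Dset: "back_set n \<subseteq> Dset R" by (cases n) auto

lemma back_set_eqv:
  assumes "z \<in> back_set n" "eqv w z"
  shows "w \<in> back_set n"
proof (cases n)
  case 0
  thus ?thesis using assms eqv_Dset[OF assms(2)] by simp
next
  case (Suc m)
  then obtain v where "z \<in> Dset R" "v \<in> back_set m" "eqv (F v) z" using assms(1) by auto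
  moreover from this have "eqv (F v) w" using eqv_trans[OF _ eqv_sym[OF assms(2)]] by blast
  ultimately show ?thesis using Suc eqv_Dset[OF assms(2)] by auto
qed

lemma back_set_Suc_subset: "back_set (Suc n) \<subseteq> back_set n"
proof (induction n)
  case (Suc n)
  thus ?case by auto
qed auto

lemma back_set_antimono: "m \<le> n \<Longrightarrow> back_set n \<subseteq> back_set m"
  using lift_Suc_antimono_le[of back_set, OF back_set_Suc_subset] by blast

lemma back_set_representative:
  assumes "w \<in> back_set n"
  obtains w' where "w' \<in> Kset R \<inter> back_set n" "eqv w' w"
proof -
  have "w \<in> Dset R" using assms back_set_Dset by blast
  then obtain m where m: "m \<in> Zlat" "tr m w \<in> Kset R" by (rule Kset_representative)
  have "eqv (tr m w) w" using eqv_tr[OF m(1)] .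
  thus ?thesis using that m(2) back_set_eqv[OF assms] by blast
qed

text \<open>Every predecessor can be moved into \<open>Kset R\<close>, so the image is a compact set
  plus a closed lattice, although D itself is not compact.\<close>

lemma closed_back_set: "closed (back_set n)"
proof (induction n)
  case 0
  show ?case by (simp add: closed_Dset)
next
  case (Suc n)
  let ?Z = "Zlat \<times> {0} :: ((real^'c) \<times> (real^'u) \<times> (real^'s)) set"
  have "compact (Kset R \<inter> back_set n)" using compact_Kset Suc by (rule compact_Int_closed)
  hence "compact (F ` (Kset R \<inter> back_set n))"
    using Kset_subset by (intro compact_continuous_image continuous_on_subset[OF cont_F]) auto
  moreover have "closed ?Z" by (intro closed_Times closed_Zlat closed_singleton)
  ultimately have cT: "closed (\<Union>x\<in>F ` (Kset R \<inter> back_set n). \<Union>y\<in>?Z. {x + y})" (is "closed ?T")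
    by (rule compact_closed_sums)
  have "back_set (Suc n) = Dset R \<inter> ?T"
  proof (intro equalityI subsetI)
    fix z assume "z \<in> back_set (Suc n)"
    then obtain w where w: "z \<in> Dset R" "w \<in> back_set n" "eqv (F w) z" by auto
    obtain w' where w': "w' \<in> Kset R \<inter> back_set n" "eqv w' w" using back_set_representative[OF w(2)] .
    have "eqv z (F w')"
      using lift_eqv[OF _ w'(2)] w(2,3) back_set_Dset eqv_trans eqv_sym by blast
    then obtain m where "m \<in> Zlat" "z = tr m (F w')" by (auto simp: eqv_iff_tr)
    hence "z = F w' + (m, 0, 0)" "(m, 0, 0) \<in> ?Z" by (auto simp: tr_def zero_prod_def)
    thus "z \<in> Dset R \<inter> ?T" using w(1) w'(1) by blast
  next
    fix z assume z: "z \<in> Dset R \<inter> ?T"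
    then obtain w m where w: "w \<in> back_set n" "m \<in> Zlat" "z = F w + (m, 0)" by auto
    hence "z = tr m (F w)" by (simp add: tr_def zero_prod_def)
    hence "eqv (F w) z" using eqv_sym[OF eqv_tr[OF w(2)]] by simp
    thus "z \<in> back_set (Suc n)" using z w(1) by auto
  qed
  thus ?case using closed_Int[OF closed_Dset cT] by (simp only:)
qed

text \<open>n graph transforms of the zero section.\<close>

lemma back_set_graph: "\<exists>b. cu_graph b \<and> (\<forall>q\<in>Q. mk q (b q) \<in> back_set n)"
proof (induction n)
  case 0
  have "cu_graph (\<lambda>q. 0)" using R_pos by (simp add: cu_graph_def)
  thus ?case by (intro exI[of _ "\<lambda>q. 0"]) (use R_pos in \<open>auto simp: mem_Q\<close>)
next
  case (Suc n)
  then obtain b where b: "cu_graph b" "\<forall>q\<in>Q. mk q (b q) \<in> back_set n" by blast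
  obtain b' where b': "cu_graph b'" "\<And>q. q \<in> Q \<Longrightarrow> \<exists>p\<in>Q. eqv (F (mk p (b p))) (mk q (b' q))"
    using cu_graph_transform[OF b(1)] by blast
  show ?case using b(2) b' cu_graph_Dset[OF b'(1)] by (intro exI[of _ b']) force
qed

lemma Wcu_predecessor:
  assumes "z \<in> Wcu F R"
  obtains w where "w \<in> Wcu F R" "eqv (F w) z"
proof -
  obtain zs where zs: "zs 0 = z" "\<forall>n. zs n \<in> Dset R \<and> eqv (F (zs (Suc n))) (zs n)"
    using assms by (auto simp: Wcu_def)
  have "zs 1 \<in> Wcu F R" unfolding Wcu_def using zs(2)
    by (intro CollectI exI[of _ "\<lambda>n. zs (Suc n)"]) simp
  thus ?thesis using that zs by (metis One_nat_def)
qed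

lemma Wcu_Dset: "z \<in> Wcu F R \<Longrightarrow> z \<in> Dset R"
  by (auto simp: Wcu_def)

lemma Wcu_step:
  assumes w: "w \<in> Wcu F R" and z: "z \<in> Dset R" "eqv (F w) z"
  shows "z \<in> Wcu F R"
proof -
  obtain zs where zs: "zs 0 = w" "\<forall>n. zs n \<in> Dset R \<and> eqv (F (zs (Suc n))) (zs n)"
    using w by (auto simp: Wcu_def)
  show ?thesis unfolding Wcu_def
    by (intro CollectI exI[of _ "case_nat z zs"]) (use zs z in \<open>auto split: nat.split\<close>)
qed

text \<open>A point with backward trajectories of every length might use a different first
  predecessor for each length. The predecessors in \<open>Kset R\<close> that allow n further steps
  form nested nonempty compact sets, so one predecessor serves all n; iterating the choice
  \<open>g\<close> gives the full trajectory.\<close>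

lemma Inter_back_set_subset_Wcu: "(\<Inter>n. back_set n) \<subseteq> Wcu F R"
proof
  fix z assume z: "z \<in> (\<Inter>n. back_set n)"
  have pred: "\<exists>w\<in>(\<Inter>n. back_set n). eqv (F w) z" if z: "z \<in> (\<Inter>n. back_set n)" for z
  proof -
    let ?Z = "Zlat \<times> {0} :: ((real^'c) \<times> (real^'u) \<times> (real^'s)) set"
    define P where "P n = (Kset R \<inter> (\<lambda>w. F w - z) -` ?Z) \<inter> back_set n" for n
    have eq: "F w - z \<in> ?Z \<longleftrightarrow> eqv (F w) z" for w
      by (cases "F w"; cases z) (auto simp: eqv_def pl_def px_def py_def zero_prod_def)
    have "closed (Kset R \<inter> (\<lambda>w. F w - z) -` ?Z)"
      by (intro continuous_closed_preimage continuous_intros continuous_on_subset[OF cont_F Kset_subset]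
          closed_Times closed_Zlat closed_singleton compact_imp_closed compact_Kset)
    hence "closed (P n)" for n unfolding P_def using closed_back_set by blast
    moreover have "P n \<subseteq> Kset R" for n by (auto simp: P_def)
    ultimately have "compact (P n)" for n
      by (metis compact_Int_closed compact_Kset inf.absorb_iff2)
    moreover have "P n \<noteq> {}" for n
    proof -
      have "z \<in> back_set (Suc n)" using z by blast
      then obtain w where w: "w \<in> back_set n" "eqv (F w) z" by auto
      obtain w' where w': "w' \<in> Kset R \<inter> back_set n" "eqv w' w" using back_set_representative[OF w(1)] .
      have "eqv (F w') z" using lift_eqv[OF _ w'(2)] w back_set_Dset eqv_trans by blast
      hence "w' \<in> P n" using w'(1) eq[of w'] by (simp add: P_def)
      thus ?thesis by blast
    qed
    moreover have "P n \<subseteq> P m" if "m \<le> n" for m n using back_set_antimono[OF that] by (auto simp: P_def)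
    ultimately have "\<Inter>(range P) \<noteq> {}" by (rule compact_nest)
    then obtain w where w: "\<forall>n. w \<in> P n" by blast
    have "w \<in> back_set n" for n using w by (simp add: P_def)
    moreover have "F w - z \<in> ?Z" using w by (simp add: P_def del: mem_Times_iff)
    hence "eqv (F w) z" by (simp only: eq)
    ultimately show ?thesis by (intro bexI[of _ w]) auto
  qed
  then obtain g where g: "\<And>z. z \<in> (\<Inter>n. back_set n) \<Longrightarrow> g z \<in> (\<Inter>n. back_set n) \<and> eqv (F (g z)) z"
    by metis
  have "(g ^^ n) z \<in> (\<Inter>n. back_set n)" for n by (induction n) (use z g in auto)
  thus "z \<in> Wcu F R" unfolding Wcu_def
    by (intro CollectI exI[of _ "\<lambda>n. (g ^^ n) z"]) (use g back_set_Dset in \<open>auto, blast\<close>)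
qed

lemma Wcu_exists:
  assumes q: "q \<in> Q"
  shows "\<exists>y. mk q y \<in> Wcu F R"
proof -
  define P where "P n = mk q ` cball 0 R \<inter> back_set n" for n
  have "compact (mk q ` cball 0 R)"
    by (intro compact_continuous_image continuous_intros compact_cball)
  hence "compact (P n)" for n unfolding P_def using closed_back_set by (rule compact_Int_closed)
  moreover have "P n \<noteq> {}" for n
  proof -
    obtain b where b: "cu_graph b" "\<forall>q\<in>Q. mk q (b q) \<in> back_set n" using back_set_graph by blast
    have "norm (b q) < R" using b(1) q by (simp add: cu_graph_def)
    hence "mk q (b q) \<in> P n" using b(2) q by (simp add: P_def)
    thus ?thesis by blast
  qed
  moreover have "P n \<subseteq> P m" if "m \<le> n" for m n using back_set_antimono[OF that] by (auto simp: P_def)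
  ultimately have "\<Inter>(range P) \<noteq> {}" by (rule compact_nest)
  thus ?thesis using Inter_back_set_subset_Wcu by (auto simp: P_def)
qed

section \<open>Uniqueness of the point over each base point\<close>

text \<open>In the cone the (lambda, x) difference is at most 1/L times the y difference, which
  turns the two weights of \<open>fy_bound\<close> into the sum defining \<open>mu_s1\<close>. The
  lift of \<open>w'\<close> is the one chosen by the cone.\<close>

lemma fy_contracts_Js:
  assumes D: "w \<in> Dset R" "w' \<in> Dset R" and J: "in_Js w (1/L) w'"
  shows "norm (py (F w') - py (F w)) \<le> mu_s1 F R L * norm (py w' - py w)"
proof -
  obtain n where n: "n \<in> Zlat"
      "norm ((pl w' + n - pl w, px w' - px w)) \<le> 1/L * norm (py w' - py w)"
    using J by (auto simp: in_Js_def)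
  have "norm (py (F (tr n w')) - py (F w)) \<le> mu_s1 F R L * norm (py w' - py w)"
  proof (rule fy_bound)
    fix z :: "('c,'u,'s) st" assume z: "z \<in> Dset R"
    have "plx (tr n w') - plx w = (pl w' + n - pl w, px w' - px w)" by (simp add: plx_def)
    hence "onorm (dlxfy F z) * norm (plx (tr n w') - plx w) \<le> onorm (dlxfy F z) * (1/L * norm (py w' - py w))"
      using n(2) onorm_pos_le[OF bounded_linear_blocks(2)[OF z]] by (intro mult_left_mono) auto
    moreover have "(onorm (dyfy F z) + 1/L * onorm (dlxfy F z)) * norm (py w' - py w) \<le> mu_s1 F R L * norm (py w' - py w)"
      using mu_s1_upper[OF L_pos z] by (rule mult_right_mono) simp
    ultimately show "onorm (dyfy F z) * norm (py (tr n w') - py w) + onorm (dlxfy F z) * norm (plx (tr n w') - plx w)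
        \<le> mu_s1 F R L * norm (py w' - py w)" by (simp add: algebra_simps)
  qed (use D in auto)
  thus ?thesis using lift_tr[OF D(2) n(1)] by (simp add: eqv_def)
qed

lemma Wcu_in_Js:
  assumes z: "z \<in> Wcu F R" "z' \<in> Wcu F R" and J: "in_Js z (1/L) z'"
  shows "py z' = py z"
proof -
  \<comment> \<open>2R bounds the y-distance of two points of D. The pair is generalised because the
    induction replaces it by predecessors, which remain in a common cone.\<close>
  have bound: "norm (py z' - py z) \<le> mu_s1 F R L ^ n * (2 * R)"
    if "z \<in> Wcu F R" "z' \<in> Wcu F R" "in_Js z (1/L) z'" for n z z'
    using that
  proof (induction n arbitrary: z z')
    case 0
    have "norm (py z' - py z) \<le> norm (py z') + norm (py z)" by (rule norm_triangle_ineq4)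
    also have "\<dots> \<le> R + R" using 0 Wcu_Dset by (intro add_mono) (auto simp: Dset_def)
    finally show ?case by simp
  next
    case (Suc n)
    obtain w where w: "w \<in> Wcu F R" "eqv (F w) z" using Wcu_predecessor[OF Suc.prems(1)] .
    obtain w' where w': "w' \<in> Wcu F R" "eqv (F w') z'" using Wcu_predecessor[OF Suc.prems(2)] .
    have D: "w \<in> Dset R" "w' \<in> Dset R" "F w \<in> Dset R" "F w' \<in> Dset R"
      using w w' Suc.prems(1,2) Wcu_Dset eqv_Dset by blast+
    have "in_Js (F w) (1/L) (F w')"
      using Suc.prems(3) by (rule in_Js_eqv[OF eqv_sym[OF w(2)] eqv_sym[OF w'(2)]])
    hence J: "in_Js w (1/L) w'" using cone D unfolding backward_cone_conditions_def by blast
    have "norm (py z' - py z) \<le> mu_s1 F R L * norm (py w' - py w)"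
      using fy_contracts_Js[OF D(1,2) J] w(2) w'(2) by (simp add: eqv_def)
    also have "\<dots> \<le> mu_s1 F R L * (mu_s1 F R L ^ n * (2 * R))"
      using Suc.IH[OF w(1) w'(1) J] mu_s1_nonneg[OF L_pos] by (rule mult_left_mono)
    finally show ?case by (simp add: mult.assoc)
  qed
  have "(\<lambda>n. mu_s1 F R L ^ n * (2 * R)) \<longlonglongrightarrow> 0 * (2 * R)"
    using mu_s1_nonneg[OF L_pos] mu_less_1 by (intro tendsto_mult LIMSEQ_power_zero tendsto_const) simp
  hence "norm (py z' - py z) \<le> 0 * (2 * R)"
    by (rule LIMSEQ_le_const) (use bound[OF z J] in auto)
  thus ?thesis by simp
qed

lemma Wcu_norm_py:
  assumes z: "z \<in> Wcu F R"
  shows "norm (py z) < R"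
proof -
  obtain v where v: "v \<in> Wcu F R" "eqv (F v) z" using Wcu_predecessor[OF z] .
  have "F v \<in> Dset R" using eqv_Dset[OF v(2)] Wcu_Dset[OF z] by simp
  hence "norm (py (F v)) < R" using no_exit_y Wcu_Dset[OF v(1)] by simp
  thus ?thesis using v(2) by (simp add: eqv_def)
qed

text \<open>Vertical displacement lies in every stable cone, so single-valuedness and the cone
  property are both instances of \<open>Wcu_in_Js\<close>.\<close>

lemma Wcu_graph:
  obtains w where "cu_graph w" "\<forall>z. z \<in> Wcu F R \<longleftrightarrow> plx z \<in> Q \<and> py z = w (plx z)"
proof -
  obtain w where w: "\<And>q. q \<in> Q \<Longrightarrow> mk q (w q) \<in> Wcu F R" using Wcu_exists by metis
  have "norm (w q) < R" if "q \<in> Q" for q using Wcu_norm_py[OF w[OF that]] by simp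
  moreover have "w q' = w q" if "q \<in> Q" "q' \<in> Q" "in_Js (mk q (w q)) (1/L) (mk q' (w q'))" for q q'
    using Wcu_in_Js[OF w w that(3)] that by simp
  ultimately have "cu_graph w" by (simp add: cu_graph_def)
  moreover have "z \<in> Wcu F R \<longleftrightarrow> plx z \<in> Q \<and> py z = w (plx z)" for z
  proof
    assume z: "z \<in> Wcu F R"
    hence q: "plx z \<in> Q" using Wcu_Dset by (auto simp: mem_Q Dset_def)
    have "in_Js (mk (plx z) (w (plx z))) (1/L) (mk (plx z) (py z))"
      using L_pos RLam_pos by (intro in_Js_mkI) auto
    thus "plx z \<in> Q \<and> py z = w (plx z)" using Wcu_in_Js[OF w[OF q] z] q by simp
  next
    assume "plx z \<in> Q \<and> py z = w (plx z)"
    thus "z \<in> Wcu F R" using w[of "plx z"] by (metis mk_simps(5))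
  qed
  ultimately show ?thesis using that by blast
qed

end

section \<open>The Lipschitz constant\<close>

context torus_lift begin

text \<open>Multiplied by K, the bound behind \<open>mu_s1\<close> is affine in K at each point,
  while \<open>K * xi_cu1P F R K\<close> is K I - K\<twosuperior> S with S \<ge> 0. \<open>N\<close>
  is the chord of \<open>K * mu_s1 F R K\<close> between M and K'.\<close>

lemma xi_cu1P_mu_s1_interpolate:
  assumes MK: "0 < M" "M \<le> K" "K \<le> K'"
    and M: "mu_s1 F R M < xi_cu1P F R M" and K': "mu_s1 F R K' < xi_cu1P F R K'"
  obtains N where "N < K * xi_cu1P F R K" "\<forall>z\<in>Dset R. K * onorm (dyfy F z) + onorm (dlxfy F z) \<le> N"
proof -
  obtain t where t: "0 \<le> t" "t \<le> 1" "K = (1 - t) * M + t * K'"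
  proof (cases "K' = M")
    case True
    thus ?thesis using MK that[of 0] by simp
  next
    case False
    hence d: "0 < K' - M" using MK by simp
    define t where "t = (K - M) / (K' - M)"
    have "t * (K' - M) = K - M" using d by (simp add: t_def)
    hence "K = (1 - t) * M + t * K'" by (simp add: algebra_simps)
    moreover have "0 \<le> t" "t \<le> 1" using MK d by (simp_all add: t_def)
    ultimately show ?thesis using that by blast
  qed
  let ?S = "SUP z\<in>(Dset R :: ('c,'u,'s) st set). onorm (dyflx F z)"
  let ?I = "INF z\<in>(Dset R :: ('c,'u,'s) st set). mset (ivl_mat (dlxflx F) (Pset R z))"
  obtain B where B: "\<And>z. z \<in> Dset R \<Longrightarrow> onorm (dyflx F z) \<le> B"
    using onorm_blocks_bounded by metis
  have S: "onorm (dyflx F z) \<le> ?S" if "z \<in> Dset R" for z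
    by (rule cSUP_upper[OF that bdd_aboveI2[OF B]])
  have S0: "0 \<le> ?S" using S[OF zero_in_Dset] onorm_pos_le[OF bounded_linear_blocks(3)[OF zero_in_Dset]] by linarith
  have xi: "xi_cu1P F R J = ?I - J * ?S" for J by (simp add: xi_cu1P_def)
  define N where "N = (1 - t) * (M * mu_s1 F R M) + t * (K' * mu_s1 F R K')"
  have up: "J * onorm (dyfy F z) + onorm (dlxfy F z) \<le> J * mu_s1 F R J" if "z \<in> Dset R" "0 < J" for z J
    using mult_left_mono[OF mu_s1_upper[OF that(2,1)], of J] that(2) by (simp add: algebra_simps)
  have "K * onorm (dyfy F z) + onorm (dlxfy F z) \<le> N" if z: "z \<in> Dset R" for z
  proof -
    have "K * onorm (dyfy F z) + onorm (dlxfy F z) =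
      (1 - t) * (M * onorm (dyfy F z) + onorm (dlxfy F z)) + t * (K' * onorm (dyfy F z) + onorm (dlxfy F z))"
      by (simp add: t(3) algebra_simps)
    also have "\<dots> \<le> N" unfolding N_def using t MK up[OF z]
      by (intro add_mono mult_left_mono) auto
    finally show ?thesis .
  qed
  moreover have "N < K * xi_cu1P F R K"
  proof -
    have "N < (1 - t) * (M * xi_cu1P F R M) + t * (K' * xi_cu1P F R K')"
    proof (cases "t = 0")
      case True
      thus ?thesis using M MK by (simp add: N_def)
    next
      case False
      have "(1 - t) * (M * mu_s1 F R M) \<le> (1 - t) * (M * xi_cu1P F R M)"
        using t M MK by (intro mult_left_mono) auto
      moreover have "t * (K' * mu_s1 F R K') < t * (K' * xi_cu1P F R K')"
        using False t K' MK by (intro mult_strict_left_mono) auto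
      ultimately show ?thesis by (simp add: N_def)
    qed
    \<comment> \<open>The chord of K I - K\<twosuperior> S lies below it by exactly this nonnegative
      multiple of S.\<close>
    also have "\<dots> = K * xi_cu1P F R K - (1 - t) * t * (K' - M)\<^sup>2 * ?S"
      unfolding xi t(3) by (simp add: power2_eq_square algebra_simps)
    also have "\<dots> \<le> K * xi_cu1P F R K" using t S0 by simp
    finally show ?thesis .
  qed
  ultimately show ?thesis using that by blast
qed

end

context cu_system begin

text \<open>Nearby points of the graph are pulled back along one local branch. Preimages are closer
  by the factor 1/xi, and along a graph of slope K the map F produces y-increments of at most
  \<open>N\<close> times their distance.\<close>

lemma cu_graph_improve:
  assumes w: "cu_graph w"
    and inv: "\<And>z. z \<in> Wcu F R \<longleftrightarrow> plx z \<in> Q \<and> py z = w (plx z)"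
    and lip: "\<And>q q'. q \<in> Q \<Longrightarrow> q' \<in> Q \<Longrightarrow> norm (w q - w q') \<le> K * norm (q - q')"
    and K: "0 < K" "0 < xi_cu1P F R K"
    and N: "\<And>z. z \<in> Dset R \<Longrightarrow> K * onorm (dyfy F z) + onorm (dlxfy F z) \<le> N"
    and q: "q \<in> Q" "q' \<in> Q"
  shows "norm (w q - w q') \<le> N / xi_cu1P F R K * norm (q - q')"
proof (rule lipschitz_local_to_global[OF convex_Q _ q])
  fix q assume q: "q \<in> Q"
  let ?G = "\<lambda>p. F (mk p (w p))"
  have W: "mk p (w p) \<in> Wcu F R" if "p \<in> Q" for p using that by (simp add: inv)
  obtain v where v: "v \<in> Wcu F R" "eqv (F v) (mk q (w q))" using Wcu_predecessor[OF W[OF q]] .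
  define p where "p = plx v"
  have p: "p \<in> Q" "v = mk p (w p)" using v(1) inv[of v] by (auto simp: p_def intro: st_eqI)
  have N0: "0 \<le> N"
    by (rule order_trans[OF _ N[OF zero_in_Dset]])
       (use K in \<open>auto intro!: add_nonneg_nonneg mult_nonneg_nonneg onorm_pos_le bounded_linear_blocks zero_in_Dset\<close>)
  have FpD: "?G p \<in> Dset R" using v(2) p(2) eqv_Dset cu_graph_Dset[OF w q] by metis
  obtain U where U: "p \<in> U" "U \<subseteq> Q" "open ((\<lambda>q. plx (?G q)) ` U)"
    "\<And>q. q \<in> U \<Longrightarrow> norm (py (?G q)) < R"
    "\<And>q q'. q \<in> U \<Longrightarrow> q' \<in> U \<Longrightarrow> norm (fst q - fst q') \<le> RLam / 2 \<and>
       xi_cu1P F R K * norm (q - q') \<le> norm (plx (?G q) - plx (?G q'))"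
    by (rule graph_map_open[OF w lip _ K(2) p(1) FpD]) (use K(1) in auto)
  obtain n where n: "n \<in> Zlat" "?G p = tr n (mk q (w q))" using v(2) p(2) by (auto simp: eqv_iff_tr)
  let ?O = "(\<lambda>v. v - (n, 0)) ` (\<lambda>q. plx (?G q)) ` U"
  have "open ?O" using U(3) by (rule open_translation_subtract)
  moreover have "q \<in> ?O"
  proof (rule image_eqI)
    show "q = plx (?G p) - (n, 0)" using n(2) by simp
    show "plx (?G p) \<in> (\<lambda>q. plx (?G q)) ` U" using U(1) by blast
  qed
  moreover have "norm (w y - w z) \<le> N / xi_cu1P F R K * norm (y - z)"
    if y: "y \<in> ?O \<inter> Q" and z: "z \<in> ?O \<inter> Q" for y z
  proof -
    \<comment> \<open>The image of a graph point has a backward trajectory, so if it lies in D it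
      lies on the graph again. Hence all points near q have preimages in the single set
      \<open>U\<close>.\<close>
    have pre: "\<exists>a\<in>U. plx (?G a) = y + (n, 0) \<and> py (?G a) = w y" if yO: "y \<in> ?O \<inter> Q" for y
    proof -
      obtain a where a: "a \<in> U" "y = plx (?G a) - (n, 0)" using yO by blast
      have Ga: "?G a = tr n (mk y (py (?G a)))" using a(2) by (intro st_eqI) auto
      hence e: "eqv (?G a) (mk y (py (?G a)))" using eqv_tr[OF n(1)] by metis
      have "mk y (py (?G a)) \<in> Dset R" using yO U(4)[OF a(1)] by (simp add: mem_Q)
      hence "mk y (py (?G a)) \<in> Wcu F R" using W[of a] a(1) U(2) e Wcu_step by blast
      hence "py (?G a) = w y" using inv by simp
      moreover have "plx (?G a) = y + (n, 0)" using a(2) by (simp add: algebra_simps)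
      ultimately show ?thesis using a(1) by blast
    qed
    obtain a where a: "a \<in> U" "plx (?G a) = y + (n, 0)" "py (?G a) = w y" using pre[OF y] by blast
    obtain c where c: "c \<in> U" "plx (?G c) = z + (n, 0)" "py (?G c) = w z" using pre[OF z] by blast
    have aQ: "a \<in> Q" and cQ: "c \<in> Q" using a(1) c(1) U(2) by auto
    have xi: "xi_cu1P F R K * norm (a - c) \<le> norm (y - z)" using U(5)[OF a(1) c(1)] a(2) c(2) by simp
    have "norm (py (?G a) - py (?G c)) \<le> N * norm (a - c)"
    proof (rule fy_bound[OF cu_graph_Dset[OF w aQ] cu_graph_Dset[OF w cQ]])
      fix v :: "('c,'u,'s) st" assume v: "v \<in> Dset R"
      have "onorm (dyfy F v) * norm (w a - w c) \<le> onorm (dyfy F v) * (K * norm (a - c))"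
        using lip[OF aQ cQ] onorm_pos_le[OF bounded_linear_blocks(1)[OF v]] by (rule mult_left_mono)
      moreover have "(K * onorm (dyfy F v) + onorm (dlxfy F v)) * norm (a - c) \<le> N * norm (a - c)"
        using N[OF v] by (rule mult_right_mono) simp
      ultimately show "onorm (dyfy F v) * norm (py (mk a (w a)) - py (mk c (w c))) +
          onorm (dlxfy F v) * norm (plx (mk a (w a)) - plx (mk c (w c))) \<le> N * norm (a - c)"
        by (simp add: algebra_simps)
    qed
    also have "N * norm (a - c) \<le> N * (norm (y - z) / xi_cu1P F R K)"
      using xi K(2) N0 by (intro mult_left_mono) (simp_all add: field_simps)
    finally show ?thesis by (simp add: a(3) c(3))
  qed
  ultimately show "\<exists>U. open U \<and> q \<in> U \<and> (\<forall>y\<in>U \<inter> Q. \<forall>z\<in>U \<inter> Q. norm (w y - w z) \<le> N / xi_cu1P F R K * norm (y - z))"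
    by blast
qed

lemma Wcu_graph_lipschitz:
  assumes w: "cu_graph w"
    and inv: "\<And>z. z \<in> Wcu F R \<longleftrightarrow> plx z \<in> Q \<and> py z = w (plx z)"
    and M: "0 < M" "M \<le> L" "mu_s1 F R M < xi_cu1P F R M"
    and muL: "mu_s1 F R L < xi_cu1P F R L"
    and q: "q \<in> Q" "q' \<in> Q"
  shows "norm (w q - w q') \<le> M * norm (q - q')"
proof -
  \<comment> \<open>Working with the least admissible constant avoids iterating the improvement and
    passing to a limit. The infimum is attained since a Lipschitz inequality is closed in the
    constant.\<close>
  define Ks where "Ks = {K. M \<le> K \<and> K \<le> L \<and> (\<forall>q\<in>Q. \<forall>q'\<in>Q. norm (w q - w q') \<le> K * norm (q - q'))}"
  have "norm (w q - w q') \<le> L * norm (q - q')" if qq: "q \<in> Q" "q' \<in> Q" for q q'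
  proof (rule lipschitz_local_to_global[OF convex_Q _ qq])
    fix x assume "x \<in> Q"
    have "norm (w y - w z) \<le> L * norm (y - z)" if yz: "y \<in> ball x (RLam/2) \<inter> Q" "z \<in> ball x (RLam/2) \<inter> Q" for y z
    proof (rule cu_graph_lipschitz[OF w])
      have "norm (fst y - fst z) \<le> norm (y - z)" by (metis fst_diff norm_fst_le prod.collapse)
      also have "\<dots> \<le> norm (y - x) + norm (z - x)" using norm_triangle_ineq4[of "y - x" "z - x"] by simp
      also have "\<dots> \<le> RLam" using yz by (auto simp: dist_norm norm_minus_commute)
      finally show "norm (fst y - fst z) \<le> RLam" .
    qed (use yz in auto)
    thus "\<exists>U. open U \<and> x \<in> U \<and> (\<forall>y\<in>U \<inter> Q. \<forall>z\<in>U \<inter> Q. norm (w y - w z) \<le> L * norm (y - z))"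
      using RLam_pos by (intro exI[of _ "ball x (RLam/2)"]) auto
  qed
  hence LK: "L \<in> Ks" using M(2) by (simp add: Ks_def)
  have bdd: "bdd_below Ks" by (rule bdd_belowI[of _ M]) (simp add: Ks_def)
  define K where "K = Inf Ks"
  have MK: "M \<le> K" unfolding K_def by (rule cInf_greatest) (use LK in \<open>auto simp: Ks_def\<close>)
  have KL: "K \<le> L" unfolding K_def using LK bdd by (rule cInf_lower)
  have lipK: "norm (w q - w q') \<le> K * norm (q - q')" if qq: "q \<in> Q" "q' \<in> Q" for q q'
  proof (cases "q = q'")
    case False
    have "norm (w q - w q') / norm (q - q') \<le> K" unfolding K_def
      by (rule cInf_greatest) (use LK False qq in \<open>auto simp: Ks_def divide_le_eq\<close>)
    thus ?thesis using False by (simp add: divide_le_eq)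
  qed simp
  obtain N where N: "N < K * xi_cu1P F R K" "\<forall>z\<in>Dset R. K * onorm (dyfy F z) + onorm (dlxfy F z) \<le> N"
    using xi_cu1P_mu_s1_interpolate[OF M(1) MK KL M(3) muL] .
  have K0: "0 < K" using M(1) MK by simp
  have "0 \<le> N"
    by (rule order_trans[OF _ bspec[OF N(2) zero_in_Dset]])
       (use K0 in \<open>auto intro!: add_nonneg_nonneg mult_nonneg_nonneg onorm_pos_le bounded_linear_blocks zero_in_Dset\<close>)
  hence xi0: "0 < xi_cu1P F R K" using N(1) K0 by (metis le_less_trans zero_less_mult_pos)
  have "K = M"
  proof (rule ccontr)
    assume "K \<noteq> M"
    hence MK': "M < K" using MK by simp
    \<comment> \<open>The maximum with M keeps the improved constant in the interval on which
      \<open>Ks\<close> is defined.\<close>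
    define K' where "K' = max M (N / xi_cu1P F R K)"
    have K': "K' < K" using MK' N(1) xi0 by (simp add: K'_def divide_less_eq)
    have "norm (w q - w q') \<le> K' * norm (q - q')" if qq: "q \<in> Q" "q' \<in> Q" for q q'
    proof -
      have "norm (w q - w q') \<le> N / xi_cu1P F R K * norm (q - q')"
        by (rule cu_graph_improve[OF w inv lipK K0 xi0 bspec[OF N(2)] qq])
      also have "\<dots> \<le> K' * norm (q - q')" by (intro mult_right_mono) (simp_all add: K'_def)
      finally show ?thesis .
    qed
    hence "K' \<in> Ks" using K' KL by (simp add: Ks_def K'_def)
    hence "K \<le> K'" unfolding K_def using bdd by (rule cInf_lower)
    thus False using K' by simp
  qed
  thus ?thesis using lipK[OF q] by simp
qed

end

lemma Ck_on_DF:
  fixes F :: "('c::finite,'u::finite,'s::finite) st \<Rightarrow> ('c,'u,'s) st"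
  assumes "Ck_on k F S" "1 \<le> k"
  shows "z \<in> S \<Longrightarrow> (F has_derivative DF F z) (at z)" "continuous_on S (\<lambda>z. DF F z v)"
proof -
  obtain D where "open S" and D: "\<forall>x\<in>S. D [] x = F x"
      "\<forall>vs. length vs < k \<longrightarrow> (\<forall>x\<in>S. (D vs has_derivative (\<lambda>v. D (v # vs) x)) (at x))"
      "\<forall>vs. length vs \<le> k \<longrightarrow> continuous_on S (D vs)"
    using assms(1) by (auto simp: Ck_on_def)
  have d: "(F has_derivative (\<lambda>v. D [v] z)) (at z)" if "z \<in> S" for z
  proof (rule has_derivative_transform_within_open[OF _ \<open>open S\<close> that])
    show "(D [] has_derivative (\<lambda>v. D [v] z)) (at z)" using D(2) assms(2) that by auto
  qed (use D(1) in auto)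
  have DF: "DF F z = (\<lambda>v. D [v] z)" if "z \<in> S" for z
    using frechet_derivative_at[OF d[OF that]] by (simp add: DF_def)
  show "(F has_derivative DF F z) (at z)" if "z \<in> S" using d[OF that] DF[OF that] by simp
  have "continuous_on S (D [v])" using D(3) assms(2) by simp
  thus "continuous_on S (\<lambda>z. DF F z v)" using DF by (simp cong: continuous_on_cong)
qed

theorem theorem3p4:
  fixes F :: "('c::finite,'u::finite,'s::finite) st \<Rightarrow> ('c,'u,'s) st"
    and R L M :: real and k :: nat
  assumes k: "1 \<le> k"
    and R: "0 < R" "R < RLam / 2"
    and L: "2 * R / RLam < L" "L < 1"
    and lift: "is_torus_lift F R"
    and smooth: "\<exists>S. open S \<and> Dset R \<subseteq> S \<and> Ck_on (k + 1) F S"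
    and cover: "covering_conditions F R L"
    and rate: "rate_conditions k F R L"
    and cone: "backward_cone_conditions F R L"
    and M: "0 < M" "M < L"
    and ratio: "xi_cu1P F R M / mu_s1 F R M > 1"
  shows "\<exists>w :: real^'c \<Rightarrow> real^'u \<Rightarrow> real^'s.
           (\<forall>l x. norm x \<le> R \<longrightarrow> norm (w l x) \<le> R) \<and>
           Wcu F R = {(l, x, w l x) | l x. norm x \<le> R} \<and>
           (\<forall>l1 x1 l2 x2. norm x1 \<le> R \<longrightarrow> norm x2 \<le> R \<longrightarrow> norm (l1 - l2) \<le> RLam \<longrightarrow>
              norm (w l1 x1 - w l2 x2) \<le> M * norm ((l1, x1) - (l2, x2)))"
proof -
  obtain S where S: "Dset R \<subseteq> S" "Ck_on (k + 1) F S" using smooth by blast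
  interpret cu_system F R L
  proof
    show "0 < R" "is_torus_lift F R" "L < 1" "covering_conditions F R L" "backward_cone_conditions F R L"
      by (fact R lift L cover cone)+
    show "0 < L" using M by simp
    show "mu_s1 F R L < 1" "0 < xi_cu1P F R L" using rate by (auto simp: rate_conditions_def)
    show "(F has_derivative DF F z) (at z)" if "z \<in> Dset R" for z
      using Ck_on_DF(1)[OF S(2), of z] that S(1) by auto
    show "continuous_on (Dset R) (\<lambda>z. DF F z v)" for v
      using Ck_on_DF(2)[OF S(2), of v] continuous_on_subset[OF _ S(1)] by simp
  qed
  obtain w where w: "cu_graph w" "\<forall>z. z \<in> Wcu F R \<longleftrightarrow> plx z \<in> Q \<and> py z = w (plx z)"
    by (rule Wcu_graph)
  \<comment> \<open>Division by zero yields 0, so a ratio above 1 excludes a vanishing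
    denominator.\<close>
  have "mu_s1 F R M \<noteq> 0" using ratio by auto
  hence "mu_s1 F R M < xi_cu1P F R M"
    using ratio mu_s1_nonneg[OF M(1)] by (simp add: less_divide_eq)
  hence lip: "norm (w q - w q') \<le> M * norm (q - q')" if "q \<in> Q" "q' \<in> Q" for q q'
    using Wcu_graph_lipschitz[OF w(1) spec[OF w(2)] M(1) _ _ _ that] M(2) rate by (auto simp: rate_conditions_def)
  show ?thesis
  proof (intro exI[of _ "\<lambda>l x. w (l, x)"] conjI allI impI)
    show "norm (w (l, x)) \<le> R" if "norm x \<le> R" for l x
      using w(1) that by (auto simp: cu_graph_def mem_Q intro: less_imp_le)
    show "Wcu F R = {(l, x, w (l, x)) | l x. norm x \<le> R}"
      by (auto simp: w(2)[rule_format] mem_Q plx_def pl_def px_def py_def)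
    show "norm (w (l1, x1) - w (l2, x2)) \<le> M * norm ((l1, x1) - (l2, x2))"
      if "norm x1 \<le> R" "norm x2 \<le> R" for l1 x1 l2 x2
      by (rule lip) (use that in \<open>simp_all add: mem_Q\<close>)
  qed
qed

end
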